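(* If the number $K$ of scenarios is a constant and all jobs have unit weight ($w_j=1$ for all $j$), then both MinMaxSTC and MinAvgSTC can be solved to optimality in polynomial time for any number $m$ of machines ($m$ part of the input).
   Context: An instance consists of jobs $[n]$, machines $[m]$, non-negative job weights $w_1\ge\dots\ge w_n$, and scenarios $S_1,\dots,S_K\subseteq[n]$. A solution is an assignment $\varphi:[n]\to[m]$; write $J_i=\varphi^{-1}(i)$. The cost of $\varphi$ in scenario $k$ is $G(\varphi,k)=\sum_{i=1}^m\sum_{j\in J_i\cap S_k} w_j\cdot|\{j'\in J_i\cap S_k: j'\le j\}|$ (the total completion time of scenario $k$ when each machine processes its jobs from $S_k$ in Shortest-Processing-Time order with processing times $p_j=w_j$, skipping jobs not in $S_k$). MinMaxSTC asks to minimize $\max_k G(\varphi,k)$; MinAvgSTC asks to minimize $\sum_k G(\varphi,k)$. *)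

theory Defs
  imports
    "HOL-Library.FuncSet"
    "HOL-Library.Log_Nat"
    "HOL-Computational_Algebra.Polynomial"
begin

section \<open>Scheduling instances with scenarios\<close>

text \<open>
  Jobs, machines and scenarios are numbered from 1. Weights are rational so that an instance is a
  finite object. The values of \<open>weight\<close> and \<open>scenario\<close> outside \<open>{1..num_jobs}\<close> and
  \<open>{1..num_scenarios}\<close> are irrelevant.
\<close>

record stc_instance =
  num_jobs :: nat
  num_machines :: nat
  num_scenarios :: nat
  weight :: "nat \<Rightarrow> rat"
  scenario :: "nat \<Rightarrow> nat set"

definition valid_instance :: "stc_instance \<Rightarrow> bool" where
  "valid_instance I \<longleftrightarrow>
     1 \<le> num_machines I \<and> 1 \<le> num_scenarios I \<and>
     (\<forall>j\<in>{1..num_jobs I}. 0 \<le> weight I j) \<and>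
     antimono_on {1..num_jobs I} (weight I) \<and>
     (\<forall>k\<in>{1..num_scenarios I}. scenario I k \<subseteq> {1..num_jobs I})"

definition unit_weights :: "stc_instance \<Rightarrow> bool" where
  "unit_weights I \<longleftrightarrow> (\<forall>j\<in>{1..num_jobs I}. weight I j = 1)"

definition assignments :: "stc_instance \<Rightarrow> (nat \<Rightarrow> nat) set" where
  "assignments I = {1..num_jobs I} \<rightarrow>\<^sub>E {1..num_machines I}"

definition jobs_on :: "stc_instance \<Rightarrow> (nat \<Rightarrow> nat) \<Rightarrow> nat \<Rightarrow> nat set" where
  "jobs_on I \<phi> i = {j\<in>{1..num_jobs I}. \<phi> j = i}"

definition scenario_cost :: "stc_instance \<Rightarrow> (nat \<Rightarrow> nat) \<Rightarrow> nat \<Rightarrow> rat" where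
  "scenario_cost I \<phi> k =
     (\<Sum>i\<in>{1..num_machines I}. \<Sum>j\<in>jobs_on I \<phi> i \<inter> scenario I k.
        weight I j * of_nat (card {j'\<in>jobs_on I \<phi> i \<inter> scenario I k. j' \<le> j}))"

definition max_cost :: "stc_instance \<Rightarrow> (nat \<Rightarrow> nat) \<Rightarrow> rat" where
  "max_cost I \<phi> = Max (scenario_cost I \<phi> ` {1..num_scenarios I})"

definition total_cost :: "stc_instance \<Rightarrow> (nat \<Rightarrow> nat) \<Rightarrow> rat" where
  "total_cost I \<phi> = (\<Sum>k\<in>{1..num_scenarios I}. scenario_cost I \<phi> k)"

definition MinMaxSTC :: "stc_instance \<Rightarrow> (nat \<Rightarrow> nat) \<Rightarrow> bool" where
  "MinMaxSTC I \<phi> \<longleftrightarrow> is_arg_min (max_cost I) (\<lambda>\<psi>. \<psi> \<in> assignments I) \<phi>"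

definition MinAvgSTC :: "stc_instance \<Rightarrow> (nat \<Rightarrow> nat) \<Rightarrow> bool" where
  "MinAvgSTC I \<phi> \<longleftrightarrow> is_arg_min (total_cost I) (\<lambda>\<psi>. \<psi> \<in> assignments I) \<phi>"


section \<open>Random access machine programs and their running time\<close>

text \<open>
  A state consists of registers, which programs name directly, and of a memory, which is addressed
  by computed values; all cells hold natural numbers. Arithmetic is restricted to addition and
  truncated subtraction. Under this restriction numbers grow by only a constant number of bits per
  step, so that the uniform cost measure used below is polynomially related to the logarithmic one
  and to the running time of Turing machines (Cook and Reckhow). An expression is charged one
  step as a whole: its size is a constant of the program.
\<close>

type_synonym ram_state = "(nat \<Rightarrow> nat) \<times> (nat \<Rightarrow> nat)"

datatype ram_exp =
    Const nat
  | Reg nat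
  | Mem ram_exp
  | Plus ram_exp ram_exp
  | Minus ram_exp ram_exp

fun eval_exp :: "ram_exp \<Rightarrow> ram_state \<Rightarrow> nat" where
  "eval_exp (Const n) s = n"
| "eval_exp (Reg r) s = fst s r"
| "eval_exp (Mem e) s = snd s (eval_exp e s)"
| "eval_exp (Plus e f) s = eval_exp e s + eval_exp f s"
| "eval_exp (Minus e f) s = eval_exp e s - eval_exp f s"

datatype ram_prog =
    Skip
  | Assign nat ram_exp
  | Store ram_exp ram_exp
  | Seq ram_prog ram_prog
  | Cond ram_exp ram_prog ram_prog
  | While ram_exp ram_prog

text \<open>
  \<open>exec c s t s'\<close>: started in \<open>s\<close>, the program \<open>c\<close> halts in \<open>s'\<close> after exactly \<open>t\<close> steps.
  A guard counts as true if its value is nonzero.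
\<close>

inductive exec :: "ram_prog \<Rightarrow> ram_state \<Rightarrow> nat \<Rightarrow> ram_state \<Rightarrow> bool" where
  exec_Skip: "exec Skip s 1 s"
| exec_Assign: "exec (Assign r e) s 1 ((fst s)(r := eval_exp e s), snd s)"
| exec_Store: "exec (Store a e) s 1 (fst s, (snd s)(eval_exp a s := eval_exp e s))"
| exec_Seq: "exec c s t s' \<Longrightarrow> exec d s' t' s'' \<Longrightarrow> exec (Seq c d) s (t + t') s''"
| exec_CondTrue: "eval_exp e s \<noteq> 0 \<Longrightarrow> exec c s t s' \<Longrightarrow> exec (Cond e c d) s (1 + t) s'"
| exec_CondFalse: "eval_exp e s = 0 \<Longrightarrow> exec d s t s' \<Longrightarrow> exec (Cond e c d) s (1 + t) s'"
| exec_WhileFalse: "eval_exp e s = 0 \<Longrightarrow> exec (While e c) s 1 s"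
| exec_WhileTrue: "eval_exp e s \<noteq> 0 \<Longrightarrow> exec c s t s' \<Longrightarrow> exec (While e c) s' t' s'' \<Longrightarrow>
    exec (While e c) s (1 + t + t') s''"

inductive_cases exec_SkipE: "exec Skip s t s'"
inductive_cases exec_AssignE: "exec (Assign r e) s t s'"
inductive_cases exec_StoreE: "exec (Store a e) s t s'"
inductive_cases exec_SeqE: "exec (Seq c d) s t s'"
inductive_cases exec_CondE: "exec (Cond e c d) s t s'"
inductive_cases exec_WhileE: "exec (While e c) s t s'"

lemma exec_deterministic:
  "exec c s t s' \<Longrightarrow> exec c s u s'' \<Longrightarrow> u = t \<and> s'' = s'"
proof (induction arbitrary: u s'' rule: exec.induct)
  case (exec_WhileFalse e s c)
  from exec_WhileFalse.prems exec_WhileFalse.hyps show ?case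
    by (auto elim: exec_WhileE)
next
  case (exec_WhileTrue e s c t s' t' s2)
  from exec_WhileTrue.prems exec_WhileTrue.hyps obtain v v' r
    where u: "u = Suc (v + v')" and c: "exec c s v r" and w: "exec (While e c) r v' s''"
    by (auto elim: exec_WhileE)
  from exec_WhileTrue.IH(1)[OF c] have "v = t" "r = s'" by simp_all
  with exec_WhileTrue.IH(2) w u show ?case by auto
next
  case (exec_Seq c s t s' d t' s2)
  from exec_Seq.prems obtain v v' r
    where u: "u = v + v'" and c: "exec c s v r" and d: "exec d r v' s''"
    by (rule exec_SeqE)
  from exec_Seq.IH(1)[OF c] have "v = t" "r = s'" by simp_all
  with exec_Seq.IH(2) d u show ?case by auto
next
  case (exec_CondTrue e s c t s' d)
  from exec_CondTrue.prems exec_CondTrue.hyps obtain v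
    where "u = Suc v" "exec c s v s''" by (auto elim: exec_CondE)
  with exec_CondTrue.IH show ?case by auto
next
  case (exec_CondFalse e s d t s' c)
  from exec_CondFalse.prems exec_CondFalse.hyps obtain v
    where "u = Suc v" "exec d s v s''" by (auto elim: exec_CondE)
  with exec_CondFalse.IH show ?case by auto
qed (auto elim: exec_SkipE exec_AssignE exec_StoreE)

text \<open>
  Inputs and outputs are lists of numbers: register 0 holds the length of the list and the memory
  cells from address 0 on hold its elements.
\<close>

definition initial_state :: "nat list \<Rightarrow> ram_state" where
  "initial_state xs =
     ((\<lambda>_. 0)(0 := length xs), (\<lambda>a. if a < length xs then xs ! a else 0))"

definition result_list :: "ram_state \<Rightarrow> nat list" where
  "result_list s = map (snd s) [0..<fst s 0]"

text \<open>
  The size of an input is its length in bits, with one delimiter per number; \<open>floorlog 2 x\<close> is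
  the number of binary digits of \<open>x\<close>.
\<close>

definition bit_size :: "nat list \<Rightarrow> nat" where
  "bit_size xs = (\<Sum>x\<leftarrow>xs. floorlog 2 x + 1)"

text \<open>
  A search problem is given by a set \<open>A\<close> of instances and a relation \<open>R\<close> between instances and
  their admissible answers.
\<close>

definition poly_time_solvable ::
  "('i \<Rightarrow> nat list) \<Rightarrow> ('i \<Rightarrow> 'o \<Rightarrow> nat list) \<Rightarrow> 'i set \<Rightarrow> ('i \<Rightarrow> 'o \<Rightarrow> bool) \<Rightarrow> bool" where
  "poly_time_solvable enc_in enc_out A R \<longleftrightarrow>
     (\<exists>(c :: ram_prog) (p :: nat poly). \<forall>I\<in>A. \<exists>t s x.
        exec c (initial_state (enc_in I)) t s \<and>
        t \<le> poly p (bit_size (enc_in I)) \<and>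
        result_list s = enc_out I x \<and> R I x)"


section \<open>Encoding of instances and assignments\<close>

text \<open>
  The weights are listed job by job as reduced fractions, and every scenario is given by the
  0/1 vector of its jobs. In particular the number of machines contributes only its binary length
  to the input size.
\<close>

definition encode_instance :: "stc_instance \<Rightarrow> nat list" where
  "encode_instance I =
     [num_jobs I, num_machines I, num_scenarios I] @
     concat (map (\<lambda>j. let (a, b) = quotient_of (weight I j) in [nat a, nat b])
       [1..<num_jobs I + 1]) @
     concat (map (\<lambda>k. map (\<lambda>j. if j \<in> scenario I k then 1 else 0) [1..<num_jobs I + 1])
       [1..<num_scenarios I + 1])"

definition encode_assignment :: "stc_instance \<Rightarrow> (nat \<Rightarrow> nat) \<Rightarrow> nat list" where
  "encode_assignment I \<phi> = map \<phi> [1..<num_jobs I + 1]"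

end

theory Submission imports Defs
begin

text \<open>
  With unit weights, \<open>x\<close> jobs of a scenario on one machine cost \<open>1 + \<dots> + x\<close>, and jobs that
  lie in the same scenarios are interchangeable. Fill the machines one after the other, adding one
  job to the current machine or moving on to the next machine in each step. All that matters of a
  partial assignment is its key: the current machine, its load in every scenario, the cost of
  every scenario so far, and for each of the \<open>2 ^ K\<close> job types the number of jobs already
  assigned. At most \<open>n\<close> machines are needed, so for constant \<open>K\<close> there are only polynomially many
  keys. Closing the initial partial assignment under these steps, keeping one representative per
  key, therefore takes polynomial time, and the best complete representative is optimal.
\<close>

section \<open>Partial assignments and their keys\<close>

text \<open>The cost of a scenario is a sum over machines, so a machine that has been left matters
  only through its contribution to that sum, and its loads can be forgotten. A partial maximum would
  not determine the final one; the key therefore carries the whole cost vector, and one table serves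
  both objectives, which enter only when complete records are compared. The obstacle is that m is
  given in binary and may be exponential in the input size; capping the machines by n makes the time
  bound independent of m. Every key entry is then at most (n + 1) ^ 3, and a key has 1 + 2 ^ K + 2 *
  K entries, so the table length is polynomial with an exponent depending on K only. The machine
  model cannot multiply. This does no harm: one more job raises the cost of a scenario by the new
  load, so triangular numbers accumulate by additions, input offsets are constant multiples of n,
  and a linear search for an equal key replaces the addressing of a multidimensional array.\<close>

definition tri :: "nat \<Rightarrow> nat" where
  "tri x = \<Sum>{..x}"

lemma tri_simps [simp]: "tri 0 = 0" "tri (Suc x) = tri x + Suc x"
  by (simp_all add: tri_def)

lemma tri_le: "tri x \<le> x * (x + 1)"
  by (induction x) auto

text \<open>Insert elements in increasing order: a new maximum has rank equal to the size of the
  enlarged set and leaves all other ranks unchanged.\<close>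

lemma sum_ranks: "finite A \<Longrightarrow> (\<Sum>j\<in>A. card {j'\<in>A. j' \<le> j}) = tri (card A)"
  for A :: "nat set"
proof (induction A rule: finite_linorder_max_induct)
  case (insert b A)
  have "{j'\<in>insert b A. j' \<le> j} = {j'\<in>A. j' \<le> j}" if "j \<in> A" for j
    using insert.hyps that by force
  moreover have "{j'\<in>insert b A. j' \<le> b} = insert b A"
    using insert.hyps by force
  moreover have "b \<notin> A" using insert.hyps by auto
  ultimately show ?case using insert by simp
qed simp

text \<open>Horner scheme with the last index as least significant bit; doubling is an addition, so
  the program can evaluate it.\<close>

primrec type_code :: "(nat \<Rightarrow> nat) \<Rightarrow> nat \<Rightarrow> nat" where
  "type_code b 0 = 0"
| "type_code b (Suc k) = 2 * type_code b k + b k"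

lemma type_code_less: "(\<And>k. b k \<le> 1) \<Longrightarrow> type_code b k < 2 ^ k"
proof (induction k)
  case (Suc k)
  then have "type_code b k < 2 ^ k" "b k \<le> 1" by auto
  then show ?case by simp
qed simp

lemma type_code_inj:
  assumes "\<And>k. b k \<le> 1" "\<And>k. b' k \<le> 1" "type_code b K = type_code b' K" "k < K"
  shows "b k = b' k"
  using assms(3,4)
proof (induction K)
  case (Suc K)
  have "b K \<le> 1" "b' K \<le> 1" using assms(1,2) by auto
  with Suc.prems(1) have "type_code b K = type_code b' K" "b K = b' K"
    by simp_all presburger+
  with Suc show ?case by (cases "k = K") auto
qed simp

text \<open>Layout of a key: the current machine at 0, then 2 ^ K type counts, K loads and K
  costs.\<close>

definition off_load :: "nat \<Rightarrow> nat" where "off_load K = 1 + 2 ^ K"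
definition off_cost :: "nat \<Rightarrow> nat" where "off_cost K = off_load K + K"
definition key_len :: "nat \<Rightarrow> nat" where "key_len K = off_cost K + K"

lemma key_cases:
  assumes "x < key_len K"
  obtains "x = 0" | t where "t < 2 ^ K" "x = Suc t" | k where "k < K" "x = off_load K + k"
    | k where "k < K" "x = off_cost K + k"
proof -
  consider "x = 0" | "x > 0" "x < off_load K" | "off_load K \<le> x" "x < off_cost K" | "off_cost K \<le> x"
    by linarith
  then show thesis
  proof cases
    case 2 then show thesis using that(2)[of "x - 1"] by (auto simp: off_load_def)
  next
    case 3 then show thesis using that(3)[of "x - off_load K"] by (auto simp: off_cost_def)
  next
    case 4 then show thesis using that(4)[of "x - off_cost K"] assms by (auto simp: key_len_def)
  qed (use that in auto)
qed

text \<open>Jobs and scenarios are counted from 0, but machines from 1, so that machine 0 can mark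
  an unassigned job.\<close>

locale compact_instance =
  fixes K n m :: nat and inc :: "nat \<Rightarrow> nat \<Rightarrow> nat"
  assumes machines: "1 \<le> m" and inc_le: "inc k j \<le> 1"
begin

definition job_type :: "nat \<Rightarrow> nat" where
  "job_type j = type_code (\<lambda>k. inc k j) K"

definition load :: "(nat \<Rightarrow> nat) \<Rightarrow> nat \<Rightarrow> nat \<Rightarrow> nat" where
  "load a i k = card {j. j < n \<and> a j = i \<and> inc k j \<noteq> 0}"

definition cost :: "nat \<Rightarrow> (nat \<Rightarrow> nat) \<Rightarrow> nat \<Rightarrow> nat" where
  "cost c a k = (\<Sum>i\<in>{1..c}. tri (load a i k))"

definition count :: "(nat \<Rightarrow> nat) \<Rightarrow> nat \<Rightarrow> nat" where
  "count a t = card {j. j < n \<and> a j \<noteq> 0 \<and> job_type j = t}"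

fun key :: "nat \<times> (nat \<Rightarrow> nat) \<Rightarrow> nat \<Rightarrow> nat" where
  "key (c, a) x =
     (if x = 0 then c
      else if x < off_load K then count a (x - 1)
      else if x < off_cost K then load a c (x - off_load K)
      else cost c a (x - off_cost K))"

declare key.simps [simp del]

lemma key_simps:
  "key (c, a) 0 = c"
  "t < 2 ^ K \<Longrightarrow> key (c, a) (Suc t) = count a t"
  "k < K \<Longrightarrow> key (c, a) (off_load K + k) = load a c k"
  "key (c, a) (off_cost K + k) = cost c a k"
  by (auto simp: key.simps off_load_def off_cost_def)

definition keys :: "nat \<times> (nat \<Rightarrow> nat) \<Rightarrow> nat list" where
  "keys s = map (key s) [0..<key_len K]"

lemma keys_eq_iff: "keys s = keys s' \<longleftrightarrow> (\<forall>x<key_len K. key s x = key s' x)"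
  by (auto simp: keys_def)

text \<open>The maximum with 1 covers n = 0, where the initial state still has a current
  machine.\<close>

fun valid :: "nat \<times> (nat \<Rightarrow> nat) \<Rightarrow> bool" where
  "valid (c, a) \<longleftrightarrow> 1 \<le> c \<and> c \<le> m \<and> c \<le> max 1 n \<and> (\<forall>j<n. a j \<le> c)"

text \<open>The argument n stands for opening the next machine. An inapplicable move changes
  nothing, so closure can be stated for all j \<le> n without guards.\<close>

fun move :: "nat \<Rightarrow> nat \<times> (nat \<Rightarrow> nat) \<Rightarrow> nat \<times> (nat \<Rightarrow> nat)" where
  "move j (c, a) =
     (if j < n then if a j = 0 then (c, a(j := c)) else (c, a)
      else if c < m \<and> c < n then (Suc c, a) else (c, a))"

lemma valid_move: "valid s \<Longrightarrow> valid (move j s)"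
  by (cases s) (auto simp: le_Suc_eq)

lemma job_type_less: "job_type j < 2 ^ K"
  unfolding job_type_def by (rule type_code_less) (rule inc_le)

lemma inc_eq_if_job_type_eq: "job_type j = job_type j' \<Longrightarrow> k < K \<Longrightarrow> inc k j = inc k j'"
  unfolding job_type_def
  by (rule type_code_inj[where b = "\<lambda>k. inc k j" and b' = "\<lambda>k. inc k j'"]) (auto intro: inc_le[simplified])

text \<open>The case i = 0 has to be excluded: a job that gets assigned leaves the jobs marked 0,
  whose load may drop.\<close>

lemma load_assign:
  assumes "j < n" "a j = 0" "c \<noteq> 0" "i \<noteq> 0"
  shows "load (a(j := c)) i k = load a i k + (if i = c then inc k j else 0)"
proof -
  have "{j'. j' < n \<and> (a(j := c)) j' = i \<and> inc k j' \<noteq> 0} =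
    (if i = c \<and> inc k j \<noteq> 0 then insert j else id) {j'. j' < n \<and> a j' = i \<and> inc k j' \<noteq> 0}"
    using assms by auto
  with inc_le[of k j] assms show ?thesis
    by (auto simp: load_def)
qed

lemma count_assign:
  assumes "j < n" "a j = 0" "c \<noteq> 0"
  shows "count (a(j := c)) t = count a t + (if t = job_type j then 1 else 0)"
proof -
  have "{j'. j' < n \<and> (a(j := c)) j' \<noteq> 0 \<and> job_type j' = t} =
    (if t = job_type j then insert j else id) {j'. j' < n \<and> a j' \<noteq> 0 \<and> job_type j' = t}"
    using assms by auto
  with assms show ?thesis
    by (auto simp: count_def)
qed

text \<open>Only machine c changes, and passing from load x to x + 1 adds x + 1 to its triangular
  number.\<close>

lemma cost_assign:
  assumes "j < n" "a j = 0" "c \<noteq> 0"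
  shows "cost c (a(j := c)) k = cost c a k + inc k j * (load a c k + 1)"
proof -
  have "cost c (a(j := c)) k =
      (\<Sum>i\<in>{1..c}. tri (load a i k) + (if i = c then inc k j * (load a c k + 1) else 0))"
    unfolding cost_def
  proof (rule sum.cong)
    fix i assume "i \<in> {1..c}"
    then show "tri (load (a(j := c)) i k) = tri (load a i k) + (if i = c then inc k j * (load a c k + 1) else 0)"
      using load_assign[where a = a and i = i and k = k, OF assms] inc_le[of k j] by (auto simp: le_Suc_eq)
  qed simp
  with assms show ?thesis
    by (simp add: sum.distrib cost_def)
qed

text \<open>The new key is computed from the old key and the scenarios of the job, without access to
  the assignment; this is why equal keys stay equal under moves. A load entry sits K places before
  the cost entry of the same scenario, whence \<open>\<kappa> (x - K)\<close>.\<close>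

definition key_assign :: "nat \<Rightarrow> (nat \<Rightarrow> nat) \<Rightarrow> nat \<Rightarrow> nat" where
  "key_assign j \<kappa> x = \<kappa> x +
     (if x = 0 then 0
      else if x < off_load K then if x = Suc (job_type j) then 1 else 0
      else if x < off_cost K then inc (x - off_load K) j
      else inc (x - off_cost K) j * (\<kappa> (x - K) + 1))"

definition key_next :: "(nat \<Rightarrow> nat) \<Rightarrow> nat \<Rightarrow> nat" where
  "key_next \<kappa> x = (if x = 0 then Suc (\<kappa> 0) else if off_load K \<le> x \<and> x < off_cost K then 0 else \<kappa> x)"

lemma key_assign_simps:
  "key_assign j \<kappa> 0 = \<kappa> 0"
  "t < 2 ^ K \<Longrightarrow> key_assign j \<kappa> (Suc t) = \<kappa> (Suc t) + (if t = job_type j then 1 else 0)"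
  "k < K \<Longrightarrow> key_assign j \<kappa> (off_load K + k) = \<kappa> (off_load K + k) + inc k j"
  "key_assign j \<kappa> (off_cost K + k) = \<kappa> (off_cost K + k) + inc k j * (\<kappa> (off_load K + k) + 1)"
proof -
  have "off_cost K + k - K = off_load K + k" by (simp add: off_cost_def)
  then show "key_assign j \<kappa> (off_cost K + k) = \<kappa> (off_cost K + k) + inc k j * (\<kappa> (off_load K + k) + 1)"
    unfolding key_assign_def by (simp, simp add: off_load_def off_cost_def)
qed (auto simp: key_assign_def off_load_def off_cost_def)

lemma key_next_simps:
  "key_next \<kappa> 0 = Suc (\<kappa> 0)"
  "t < 2 ^ K \<Longrightarrow> key_next \<kappa> (Suc t) = \<kappa> (Suc t)"
  "k < K \<Longrightarrow> key_next \<kappa> (off_load K + k) = 0"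
  "key_next \<kappa> (off_cost K + k) = \<kappa> (off_cost K + k)"
  by (auto simp: key_next_def off_load_def off_cost_def)

lemma key_assign:
  assumes "j < n" "a j = 0" "c \<noteq> 0" "x < key_len K"
  shows "key (c, a(j := c)) x = key_assign j (key (c, a)) x"
  using assms(4)
  by (cases rule: key_cases)
    (use assms in \<open>simp_all add: key_assign_simps key_simps count_assign load_assign cost_assign job_type_less\<close>)

text \<open>No job lies beyond machine c, so the new machine has load 0 and adds nothing to any
  cost.\<close>

lemma key_next:
  assumes "\<And>j. j < n \<Longrightarrow> a j \<le> c" "x < key_len K"
  shows "key (Suc c, a) x = key_next (key (c, a)) x"
proof -
  have 0: "load a (Suc c) k = 0" for k
    using assms(1) by (force simp: load_def)
  then have 1: "cost (Suc c) a k = cost c a k" for k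
    by (simp add: cost_def)
  from assms(2) show ?thesis
    by (cases rule: key_cases) (simp_all add: key_next_simps key_simps 0 1)
qed

section \<open>Bounds on key entries and on the number of keys\<close>

lemma count_le: "count a t \<le> n"
  unfolding count_def by (rule order_trans[OF card_mono[of "{..<n}"]]) auto

lemma load_le: "load a i k \<le> n"
  unfolding load_def by (rule order_trans[OF card_mono[of "{..<n}"]]) auto

lemma cost_le: "cost c a k \<le> c * (n * (n + 1))"
proof -
  have "tri (load a i k) \<le> n * (n + 1)" for i
    by (rule order_trans[OF tri_le mult_mono]) (use load_le in auto)
  then show ?thesis
    unfolding cost_def using sum_bounded_above[of "{1..c}" "\<lambda>i. tri (load a i k)"] by simp
qed

lemma key_le:
  assumes "valid s"
  shows "key s x \<le> (n + 1) ^ 3"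
proof -
  obtain c a where s: "s = (c, a)" by (cases s)
  have c: "c \<le> n + 1" using assms s by auto
  have "cost c a k \<le> (n + 1) ^ 3" for k
    by (rule order_trans[OF cost_le], unfold power3_eq_cube mult.assoc)
      (intro mult_mono c, auto)
  moreover have "n + 1 \<le> (n + 1) ^ 3" by (rule self_le_power) auto
  ultimately show ?thesis
    unfolding s using c order_trans[OF count_le] order_trans[OF load_le] by (simp add: key.simps)
qed

text \<open>Distinct keys embed the table into the lists of length \<open>key_len K\<close> over the
  (n + 1) ^ 3 + 1 possible entry values.\<close>

lemma length_le_if_distinct_keys:
  assumes "distinct (map keys rs)" "\<forall>s\<in>set rs. valid s"
  shows "length rs \<le> ((n + 1) ^ 3 + 1) ^ key_len K"
proof -
  have "keys ` set rs \<subseteq> {xs. set xs \<subseteq> {..(n + 1) ^ 3} \<and> length xs = key_len K}"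
    using assms(2) key_le by (auto simp: keys_def simp del: valid.simps)
  then have "card (keys ` set rs) \<le> card {xs. set xs \<subseteq> {..(n + 1) ^ 3} \<and> length xs = key_len K}"
    by (intro card_mono finite_lists_length_eq) auto
  with distinct_card[OF assms(1)] show ?thesis
    by (simp add: card_lists_length_eq)
qed

section \<open>Completeness of a table closed under moves\<close>

definition closed :: "(nat \<times> (nat \<Rightarrow> nat)) list \<Rightarrow> bool" where
  "closed rs \<longleftrightarrow> (\<forall>s\<in>set rs. \<forall>j\<le>n. keys (move j s) \<in> keys ` set rs)"

text \<open>All types are below 2 ^ K, so they partition the assigned jobs; whether an assignment is
  complete can hence be read off its key.\<close>

lemma sum_count: "(\<Sum>t<2 ^ K. count a t) = card {j. j < n \<and> a j \<noteq> 0}"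
proof -
  let ?X = "{j. j < n \<and> a j \<noteq> 0}"
  have "(\<Sum>t<2 ^ K. \<Sum>j | j \<in> ?X \<and> job_type j = t. 1 :: nat) = (\<Sum>j\<in>?X. 1)"
    by (rule sum.group) (auto simp: job_type_less)
  then show ?thesis by (simp add: count_def conj_assoc del: neq0_conv)
qed

text \<open>Key equality is a bisimulation up to exchanging jobs of equal type, so one representative
  per key suffices.\<close>

lemma closed_complete:
  assumes init: "(1, \<lambda>_. 0) \<in> set rs" and valid: "\<forall>s\<in>set rs. valid s" and closed: "closed rs"
  shows "valid (c, a) \<Longrightarrow> keys (c, a) \<in> keys ` set rs"
\<comment> \<open>Both ways of undoing a move lower this measure: removing a job from the current
  machine, and giving up an empty current machine.\<close>
proof (induction "c + card {j. j < n \<and> a j \<noteq> 0}" arbitrary: c a rule: less_induct)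
  case less
  show ?case
  proof (cases "\<exists>j<n. a j = c")
    case True
    then obtain j where j: "j < n" "a j = c" by auto
    have c: "c \<noteq> 0" using less.prems by auto
    let ?a = "a(j := 0)"
    have a: "?a(j := c) = a" using j by auto
    have sub: "{j. j < n \<and> ?a j \<noteq> 0} \<subset> {j. j < n \<and> a j \<noteq> 0}" using j c by auto
    have "card {j. j < n \<and> ?a j \<noteq> 0} < card {j. j < n \<and> a j \<noteq> 0}"
      by (rule psubset_card_mono[OF _ sub]) simp
    then have "keys (c, ?a) \<in> keys ` set rs"
      by (intro less.hyps) (use less.prems in auto)
    then obtain c' a' where s: "(c', a') \<in> set rs" "keys (c', a') = keys (c, ?a)"
      by (metis imageE surj_pair)
    then have keq: "key (c', a') x = key (c, ?a) x" if "x < key_len K" for x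
      using that by (auto simp: keys_eq_iff)
    have "c' = c" using keq[of 0] by (simp add: key_len_def off_cost_def off_load_def key_simps)
    \<comment> \<open>The representative uses as many jobs of the type of \<open>j\<close> as the
      assignment without \<open>j\<close> does, so some job \<open>j'\<close> of that type is still
      free in it and can play the role of \<open>j\<close>.\<close>
    have "count a' (job_type j) = count ?a (job_type j)"
      using keq[of "Suc (job_type j)"] job_type_less[of j]
      by (simp add: key_len_def off_cost_def off_load_def key_simps)
    also have "\<dots> < card {j'. j' < n \<and> job_type j' = job_type j}"
      unfolding count_def by (rule psubset_card_mono) (use j in auto)
    finally have "{j'. j' < n \<and> job_type j' = job_type j} \<noteq> {j'. j' < n \<and> a' j' \<noteq> 0 \<and> job_type j' = job_type j}"
      unfolding count_def by (rule contrapos_pn) simp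
    then obtain j' where j': "j' < n" "a' j' = 0" "job_type j' = job_type j"
      by blast
    have "key (c, a) x = key (move j' (c', a')) x" if x: "x < key_len K" for x
    proof -
      have "key_assign j (key (c, ?a)) x = key_assign j' (key (c', a')) x"
        using x
      proof (cases rule: key_cases)
        \<comment> \<open>The update of a cost entry also reads a load entry, so agreement of the
          old keys is used at two positions.\<close>
        case (4 k)
        have "off_load K + k < key_len K" using 4 by (simp add: key_len_def off_cost_def)
        then show ?thesis
          using inc_eq_if_job_type_eq[OF j'(3) 4(1)] keq x 4 by (simp add: key_assign_simps)
      qed (use keq[OF x] inc_eq_if_job_type_eq[OF j'(3)] j'(3) in \<open>auto simp: key_assign_simps\<close>)
      moreover have "key (c, a) x = key_assign j (key (c, ?a)) x"
        using key_assign[of j ?a c x] j c x by (simp only: a fun_upd_same simp_thms True_implies_equals)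
      ultimately show ?thesis
        using key_assign[of j' a' c x] j' c x \<open>c' = c\<close> by simp
    qed
    then have "keys (c, a) = keys (move j' (c', a'))" by (simp add: keys_eq_iff)
    then show ?thesis using closed s(1) j'(1) by (auto simp: closed_def simp del: move.simps)
  next
    case False
    then have lt: "\<forall>j<n. a j < c" using less.prems by (auto simp: le_less)
    show ?thesis
    proof (cases "c = 1")
      case True
      with lt have 0: "count a t = 0" "load a 1 k = 0" for t k
        by (auto simp: count_def load_def)
      have 1: "count (\<lambda>_. 0) t = 0" "load (\<lambda>_. 0) 1 k = 0" for t k
        by (auto simp: count_def load_def)
      have "key (1, a) x = key (1, \<lambda>_. 0) x" for x
        by (simp add: key.simps cost_def 0[simplified] 1[simplified])
      then have "keys (c, a) = keys (1, \<lambda>_. 0)"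
        by (simp add: keys_eq_iff True)
      with init show ?thesis by force
    next
      case False
      then obtain d where d: "c = Suc d" "d \<ge> 1" using less.prems by (cases c) auto
      then have v: "valid (d, a)" using less.prems lt by auto
      then have "keys (d, a) \<in> keys ` set rs"
        by (intro less.hyps) (use d in auto)
      then obtain c' a' where s: "(c', a') \<in> set rs" "keys (c', a') = keys (d, a)"
        by (metis imageE surj_pair)
      then have keq: "key (c', a') x = key (d, a) x" if "x < key_len K" for x
        using that by (auto simp: keys_eq_iff)
      have "c' = d" using keq[of 0] by (simp add: key_len_def off_cost_def off_load_def key_simps)
      have v': "valid (d, a')" using valid s(1) \<open>c' = d\<close> by auto
      \<comment> \<open>As c \<ge> 2 and c \<le> max 1 n, also c \<le> n; neither guard of
        \<open>move\<close> blocks the step from d to c.\<close>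
      have mv: "move n (c', a') = (c, a')" using less.prems d \<open>c' = d\<close> by auto
      have "key (c, a) x = key (c, a') x" if x: "x < key_len K" for x
        using key_next[of a d x] key_next[of a' d x] v v' keq[OF x] keq[of 0] x \<open>c' = d\<close> d
        by (auto simp: key_next_def)
      then have "keys (c, a) = keys (move n (c', a'))" unfolding mv by (simp add: keys_eq_iff)
      then show ?thesis using closed s(1) by (auto simp: closed_def simp del: move.simps)
    qed
  qed
qed

end

section \<open>Total correctness with time bounds\<close>

text \<open>Execution is deterministic, so one run within the bound is the only run.\<close>

definition halts_within :: "ram_prog \<Rightarrow> ram_state \<Rightarrow> nat \<Rightarrow> (ram_state \<Rightarrow> bool) \<Rightarrow> bool" where
  "halts_within c s T Q \<longleftrightarrow> (\<exists>t s'. exec c s t s' \<and> t \<le> T \<and> Q s')"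

lemma halts_within_mono:
  "halts_within c s T Q \<Longrightarrow> T \<le> T' \<Longrightarrow> (\<And>s'. Q s' \<Longrightarrow> Q' s') \<Longrightarrow> halts_within c s T' Q'"
  unfolding halts_within_def by (meson order_trans)

lemma halts_within_Skip: "Q s \<Longrightarrow> 1 \<le> T \<Longrightarrow> halts_within Skip s T Q"
  unfolding halts_within_def by (blast intro: exec.intros)

lemma halts_within_Assign:
  "Q (f(r := eval_exp e (f, M)), M) \<Longrightarrow> halts_within (Assign r e) (f, M) 1 Q"
  unfolding halts_within_def using exec_Assign[of r e "(f, M)"] by auto

lemma halts_within_Store:
  "Q (f, M(eval_exp a (f, M) := eval_exp e (f, M))) \<Longrightarrow> halts_within (Store a e) (f, M) 1 Q"
  unfolding halts_within_def using exec_Store[of a e "(f, M)"] by auto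

lemma halts_within_Seq:
  assumes "halts_within c s T P" "\<And>f M. P (f, M) \<Longrightarrow> halts_within d (f, M) T' Q"
  shows "halts_within (Seq c d) s (T + T') Q"
proof -
  from assms(1) obtain t f M where "exec c s t (f, M)" "t \<le> T" "P (f, M)"
    unfolding halts_within_def by auto
  with assms(2)[of f M] show ?thesis
    unfolding halts_within_def by (meson exec_Seq add_mono)
qed

text \<open>With the requirement on \<open>d\<close> itself as intermediate assertion, chains of
  assignments are executed symbolically by repeated introduction.\<close>

lemma halts_within_SeqI:
  "halts_within c s T (\<lambda>s'. halts_within d s' T' Q) \<Longrightarrow> halts_within (Seq c d) s (T + T') Q"
  by (erule halts_within_Seq)

lemma halts_within_Cond:
  assumes "eval_exp e s \<noteq> 0 \<Longrightarrow> halts_within c s T Q" "eval_exp e s = 0 \<Longrightarrow> halts_within d s T Q"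
  shows "halts_within (Cond e c d) s (1 + T) Q"
  using assms unfolding halts_within_def
  by (cases "eval_exp e s = 0") (meson exec_CondFalse exec_CondTrue add_mono order_refl)+

text \<open>The index of \<open>Inv\<close> counts iterations and N - i is the variant. Each
  iteration pays T and one step for the guard; the final 1 is the failing guard.\<close>

lemma halts_within_While:
  assumes step: "\<And>i f M. Inv i (f, M) \<Longrightarrow> eval_exp e (f, M) \<noteq> 0 \<Longrightarrow>
      i < N \<and> halts_within c (f, M) T (Inv (Suc i))"
    and init: "Inv 0 s"
  shows "halts_within (While e c) s (N * (T + 1) + 1) (\<lambda>s'. \<exists>i. Inv i s' \<and> eval_exp e s' = 0)"
proof -
  have "halts_within (While e c) s ((N - i) * (T + 1) + 1) (\<lambda>s'. \<exists>i. Inv i s' \<and> eval_exp e s' = 0)"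
    if "Inv i s" for i s
    using that
  proof (induction "N - i" arbitrary: i s)
    case *: 0
    have "eval_exp e s = 0" using step[of i "fst s" "snd s"] * by auto
    with * show ?case unfolding halts_within_def by (intro exI[of _ 1] exI[of _ s]) (auto intro: exec_WhileFalse[unfolded One_nat_def])
  next
    case (Suc d)
    show ?case
    proof (cases "eval_exp e s = 0")
      case True
      with Suc.prems show ?thesis unfolding halts_within_def by (intro exI[of _ 1] exI[of _ s]) (auto intro: exec_WhileFalse[unfolded One_nat_def])
    next
      case False
      with step[of i "fst s" "snd s"] Suc.prems
      obtain t s' where t: "i < N" "exec c s t s'" "t \<le> T" "Inv (Suc i) s'"
        unfolding halts_within_def by auto
      moreover have "d = N - Suc i" using Suc.hyps(2) by simp
      ultimately obtain u s'' where u: "exec (While e c) s' u s''" "u \<le> (N - Suc i) * (T + 1) + 1"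
        "\<exists>i. Inv i s'' \<and> eval_exp e s'' = 0"
        using Suc.hyps(1)[of "Suc i" s'] unfolding halts_within_def by auto
      have "(N - i) * (T + 1) = (N - Suc i) * (T + 1) + (T + 1)"
        using t(1) by (simp only: Suc_diff_Suc[symmetric] mult_Suc add.commute)
      then have "1 + t + u \<le> (N - i) * (T + 1) + 1" using t(3) u(2) by simp
      with exec_WhileTrue[OF False t(2) u(1)] u(3) show ?thesis
        unfolding halts_within_def by blast
    qed
  qed
  from this[of 0 s] init show ?thesis by simp
qed

definition seqs :: "ram_prog list \<Rightarrow> ram_prog" where
  "seqs cs = foldr Seq cs Skip"

text \<open>The loop over scenarios is unrolled in the program text, as K is a constant; its index
  lives in no register.\<close>

lemma halts_within_seqs:
  assumes step: "\<And>k f M. k < K \<Longrightarrow> Inv k (f, M) \<Longrightarrow> halts_within (c k) (f, M) T (Inv (Suc k))"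
    and init: "Inv 0 s"
  shows "halts_within (seqs (map c [0..<K])) s (K * T + 1) (Inv K)"
proof -
  have "halts_within (seqs (map c [k..<K])) s ((K - k) * T + 1) (Inv K)" if "k \<le> K" "Inv k s" for k s
    using that
  proof (induction "K - k" arbitrary: k s)
    case 0
    then show ?case by (auto simp: seqs_def intro!: halts_within_Skip)
  next
    case (Suc d)
    then have eq: "seqs (map c [k..<K]) = Seq (c k) (seqs (map c [Suc k..<K]))"
        "(K - k) * T + 1 = T + ((K - Suc k) * T + 1)"
      by (auto simp: seqs_def upt_conv_Cons Suc_diff_Suc simp flip: mult_Suc)
    show ?case
      unfolding eq
    proof (rule halts_within_Seq)
      show "halts_within (c k) s T (Inv (Suc k))"
        using step[of k "fst s" "snd s"] Suc by auto
    qed (use Suc in auto)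
  qed
  from this[of 0 s] init show ?thesis by simp
qed

section \<open>The search program\<close>

text \<open>Replaces multiplication, which expressions lack; the factor is a constant of the
  program.\<close>

primrec times_exp :: "nat \<Rightarrow> ram_exp \<Rightarrow> ram_exp" where
  "times_exp 0 e = Const 0"
| "times_exp (Suc c) e = Plus e (times_exp c e)"

lemma eval_times_exp [simp]: "eval_exp (times_exp c e) s = c * eval_exp e s"
  by (induction c) auto

definition sum_exp :: "ram_exp list \<Rightarrow> ram_exp" where
  "sum_exp es = foldr Plus es (Const 0)"

lemma eval_sum_exp: "eval_exp (sum_exp es) s = sum_list (map (\<lambda>e. eval_exp e s) es)"
  unfolding sum_exp_def by (induction es) auto

text \<open>With truncated subtraction, e + (f - e) is the maximum of e and f.\<close>

definition max_exp :: "ram_exp list \<Rightarrow> ram_exp" where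
  "max_exp es = foldr (\<lambda>e f. Plus e (Minus f e)) es (Const 0)"

lemma eval_max_exp: "eval_exp (max_exp es) s = foldr max (map (\<lambda>e. eval_exp e s) es) 0"
  unfolding max_exp_def by (induction es) auto

text \<open>Registers: 0 end of the input and start of the table, 1 number of jobs, 2 number of machines,
  3 record length, 4 record being expanded, 5 end of the table, 6 job, 7 scratch, 8 best record.\<close>

definition inc_exp :: "nat \<Rightarrow> ram_exp" where
  "inc_exp k = Mem (Plus (Plus (Const 3) (times_exp (k + 2) (Reg 1))) (Reg 6))"

primrec type_exp :: "nat \<Rightarrow> ram_exp" where
  "type_exp 0 = Const 0"
| "type_exp (Suc k) = Plus (Plus (type_exp k) (type_exp k)) (inc_exp k)"

definition cell :: "nat \<Rightarrow> nat \<Rightarrow> ram_exp" where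
  "cell r x = Plus (Reg r) (Const x)"

lemma eval_cell [simp]: "eval_exp (cell r x) (f, M) = f r + x"
  by (simp add: cell_def)

definition add_to :: "ram_exp \<Rightarrow> ram_exp \<Rightarrow> ram_prog" where
  "add_to a e = Store a (Plus (Mem a) e)"

text \<open>The order of the last two stores matters: the cost grows by the load after its
  increment.\<close>

definition assign_prog :: "nat \<Rightarrow> ram_prog" where
  "assign_prog K =
     Seq (Store (Plus (cell 5 (key_len K)) (Reg 6)) (Mem (cell 5 0)))
    (Seq (add_to (Plus (cell 5 1) (type_exp K)) (Const 1))
         (seqs (map (\<lambda>k. Cond (inc_exp k)
            (Seq (add_to (cell 5 (off_load K + k)) (Const 1))
                 (add_to (cell 5 (off_cost K + k)) (Mem (cell 5 (off_load K + k)))))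
            Skip) [0..<K])))"

definition next_prog :: "nat \<Rightarrow> ram_prog" where
  "next_prog K =
     Seq (add_to (cell 5 0) (Const 1))
         (seqs (map (\<lambda>k. Store (cell 5 (off_load K + k)) (Const 0)) [0..<K]))"

definition move_prog :: "nat \<Rightarrow> ram_prog" where
  "move_prog K =
     Cond (Minus (Reg 1) (Reg 6))
       (Cond (Mem (Plus (cell 5 (key_len K)) (Reg 6))) Skip (assign_prog K))
       (Cond (Minus (Reg 2) (Mem (cell 5 0)))
         (Cond (Minus (Reg 1) (Mem (cell 5 0))) (next_prog K) Skip) Skip)"

definition copy_prog :: ram_prog where
  "copy_prog =
     Seq (Assign 7 (Const 0))
         (While (Minus (Reg 3) (Reg 7))
           (Seq (Store (Plus (Reg 5) (Reg 7)) (Mem (Plus (Reg 4) (Reg 7))))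
                (Assign 7 (Plus (Reg 7) (Const 1)))))"

text \<open>Of the two truncated differences one is 0 and the other the distance, so the sum
  vanishes exactly if the keys agree.\<close>

definition differ_exp :: "nat \<Rightarrow> ram_exp" where
  "differ_exp K = sum_exp (map (\<lambda>x.
     Plus (Minus (Mem (cell 7 x)) (Mem (cell 5 x))) (Minus (Mem (cell 5 x)) (Mem (cell 7 x)))) [0..<key_len K])"

text \<open>The new record itself, stored behind the table, serves as the sentinel of the search.\<close>

definition insert_prog :: "nat \<Rightarrow> ram_prog" where
  "insert_prog K =
     Seq (Assign 7 (Reg 0))
    (Seq (While (differ_exp K) (Assign 7 (Plus (Reg 7) (Reg 3))))
         (Cond (Minus (Reg 5) (Reg 7)) Skip (Assign 5 (Plus (Reg 5) (Reg 3)))))"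

definition expand_prog :: "nat \<Rightarrow> ram_prog" where
  "expand_prog K =
     Seq (Assign 6 (Const 0))
    (Seq (While (Minus (Plus (Reg 1) (Const 1)) (Reg 6))
           (Seq copy_prog (Seq (move_prog K) (Seq (insert_prog K) (Assign 6 (Plus (Reg 6) (Const 1)))))))
         (Assign 4 (Plus (Reg 4) (Reg 3))))"

text \<open>A single store creates the first record: memory behind the input is zero, and the key of
  the empty assignment is zero except for its machine number 1.\<close>

definition init_prog :: "nat \<Rightarrow> ram_prog" where
  "init_prog K =
     Seq (Assign 1 (Mem (Const 0)))
    (Seq (Assign 2 (Mem (Const 1)))
    (Seq (Assign 3 (Plus (Const (key_len K)) (Reg 1)))
    (Seq (Assign 4 (Reg 0))
    (Seq (Assign 5 (Plus (Reg 0) (Reg 3)))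
    (Seq (Assign 8 (Reg 0))
         (Store (Reg 0) (Const 1)))))))"

definition unassigned_exp :: "nat \<Rightarrow> nat \<Rightarrow> ram_exp" where
  "unassigned_exp K r = Minus (Reg 1) (sum_exp (map (\<lambda>t. Mem (cell r (Suc t))) [0..<2 ^ K]))"

definition costs_exp :: "nat \<Rightarrow> nat \<Rightarrow> ram_exp list" where
  "costs_exp K r = map (\<lambda>k. Mem (cell r (off_cost K + k))) [0..<K]"

text \<open>\<open>g\<close> builds the objective from the cost expressions. The provisional best
  may be incomplete; then any complete record replaces it, whereas a complete one gives way only to
  a strict improvement.\<close>

definition best_prog :: "(ram_exp list \<Rightarrow> ram_exp) \<Rightarrow> nat \<Rightarrow> ram_prog" where
  "best_prog g K =
     Seq (Assign 4 (Reg 0))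
         (While (Minus (Reg 5) (Reg 4))
           (Seq (Cond (unassigned_exp K 4) Skip
                  (Cond (unassigned_exp K 8) (Assign 8 (Reg 4))
                    (Cond (Minus (g (costs_exp K 8)) (g (costs_exp K 4))) (Assign 8 (Reg 4)) Skip)))
                (Assign 4 (Plus (Reg 4) (Reg 3)))))"

definition output_prog :: "nat \<Rightarrow> ram_prog" where
  "output_prog K =
     Seq (Assign 6 (Const 0))
    (Seq (While (Minus (Reg 1) (Reg 6))
           (Seq (Store (Reg 6) (Mem (Plus (cell 8 (key_len K)) (Reg 6))))
                (Assign 6 (Plus (Reg 6) (Const 1)))))
         (Assign 0 (Reg 1)))"

definition solver :: "(ram_exp list \<Rightarrow> ram_exp) \<Rightarrow> nat \<Rightarrow> ram_prog" where
  "solver g K =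
     Seq (init_prog K)
    (Seq (While (Minus (Reg 5) (Reg 4)) (expand_prog K))
    (Seq (best_prog g K) (output_prog K)))"

section \<open>Correctness of the search program\<close>

context compact_instance
begin

text \<open>Three header cells, two cells per weight fraction and K incidence rows; row k thus
  starts at 3 + (k + 2) * n.\<close>

definition table_start :: nat where "table_start = 3 + 2 * n + K * n"

definition record_len :: nat where "record_len = key_len K + n"

definition params :: "(nat \<Rightarrow> nat) \<Rightarrow> bool" where
  "params f \<longleftrightarrow> f 0 = table_start \<and> f 1 = n \<and> f 2 = m \<and> f 3 = record_len"

definition input_mem :: "(nat \<Rightarrow> nat) \<Rightarrow> bool" where
  "input_mem M \<longleftrightarrow> M 0 = n \<and> M 1 = m \<and> (\<forall>k<K. \<forall>j<n. M (3 + (k + 2) * n + j) = inc k j)"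

text \<open>A record holds the assignment behind its key: keys are what the search compares, but
  free jobs and the output are read from the assignment.\<close>

definition represents :: "(nat \<Rightarrow> nat) \<Rightarrow> nat \<Rightarrow> nat \<times> (nat \<Rightarrow> nat) \<Rightarrow> bool" where
  "represents M u s \<longleftrightarrow>
     (\<forall>x<key_len K. M (u + x) = key s x) \<and> (\<forall>j<n. M (u + key_len K + j) = snd s j)"

definition table :: "(nat \<Rightarrow> nat) \<Rightarrow> (nat \<times> (nat \<Rightarrow> nat)) list \<Rightarrow> bool" where
  "table M rs \<longleftrightarrow> (\<forall>i<length rs. represents M (table_start + i * record_len) (rs ! i))"

lemma key_len_pos: "key_len K > 0"
  by (simp add: key_len_def off_cost_def off_load_def)

lemma input_cell_less: "k < K \<Longrightarrow> j < n \<Longrightarrow> 3 + (k + 2) * n + j < table_start"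
proof -
  assume "k < K" "j < n"
  then have "k * n + n \<le> K * n" by (metis Suc_leI add.commute mult_Suc mult_le_mono1)
  then show ?thesis using \<open>j < n\<close> by (simp add: table_start_def algebra_simps)
qed

lemma input_mem_cong:
  assumes "\<And>a. a < table_start \<Longrightarrow> M' a = M a" "input_mem M"
  shows "input_mem M'"
  using assms input_cell_less unfolding input_mem_def by (simp add: table_start_def)

lemma represents_cong:
  assumes "\<And>x. x < record_len \<Longrightarrow> M' (u' + x) = M (u + x)" "represents M u s"
  shows "represents M' u' s"
proof -
  have "M' (u' + x) = M (u + x)" if "x < key_len K" for x
    using assms(1)[of x] that by (simp add: record_len_def)
  moreover have "M' (u' + key_len K + j) = M (u + key_len K + j)" if "j < n" for j
    using assms(1)[of "key_len K + j"] that by (simp add: record_len_def add.assoc)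
  ultimately show ?thesis using assms(2) by (simp add: represents_def)
qed

lemma record_less: "i < N \<Longrightarrow> x < record_len \<Longrightarrow> i * record_len + x < N * record_len"
proof -
  assume "i < N" "x < record_len"
  then have "i * record_len + record_len \<le> N * record_len" by (metis Suc_leI add.commute mult_Suc mult_le_mono1)
  with \<open>x < record_len\<close> show ?thesis by simp
qed

lemma table_cong:
  assumes "\<And>a. a < table_start + length rs * record_len \<Longrightarrow> M' a = M a" "table M rs"
  shows "table M' rs"
  unfolding table_def
proof (intro allI impI)
  fix i assume i: "i < length rs"
  show "represents M' (table_start + i * record_len) (rs ! i)"
    by (rule represents_cong[where M = M and u = "table_start + i * record_len"])
      (use assms i record_less[OF i] in \<open>auto simp: table_def add.assoc\<close>)
qed

lemma eval_inc_exp: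
  assumes "input_mem M" "params f" "k < K" "f 6 < n"
  shows "eval_exp (inc_exp k) (f, M) = inc k (f 6)"
  using assms by (simp add: inc_exp_def input_mem_def params_def)

lemma eval_type_exp:
  assumes "input_mem M" "params f" "f 6 < n"
  shows "eval_exp (type_exp K) (f, M) = job_type (f 6)"
proof -
  have "eval_exp (type_exp k) (f, M) = type_code (\<lambda>k. inc k (f 6)) k" if "k \<le> K" for k
    using that by (induction k) (auto simp: eval_inc_exp[OF assms(1,2) _ assms(3)])
  then show ?thesis by (simp add: job_type_def)
qed

lemma copy_prog:
  assumes "f 4 + record_len \<le> f 5" "f 3 = record_len"
  shows "halts_within copy_prog (f, M) (3 * record_len + 2)
    (\<lambda>(f', M'). f' = f(7 := record_len) \<and> (\<forall>a<f 5. M' a = M a) \<and> (\<forall>x<record_len. M' (f 5 + x) = M (f 4 + x)))"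
proof -
  define Inv where "Inv x s \<longleftrightarrow> x \<le> record_len \<and> fst s = f(7 := x) \<and>
      (\<forall>a<f 5. snd s a = M a) \<and> (\<forall>y<x. snd s (f 5 + y) = M (f 4 + y))" for x s
  have "halts_within copy_prog (f, M) (1 + (record_len * ((1 + 1) + 1) + 1))
    (\<lambda>s. \<exists>x. Inv x s \<and> eval_exp (Minus (Reg 3) (Reg 7)) s = 0)"
    unfolding copy_prog_def
  proof (intro halts_within_SeqI halts_within_Assign halts_within_While, goal_cases)
    case (1 i g N)
    then have i: "i < record_len" using assms by (auto simp: Inv_def)
    show ?case
      by (intro conjI i halts_within_SeqI halts_within_Store halts_within_Assign)
        (use 1 assms i in \<open>auto simp: Inv_def less_Suc_eq\<close>)
  qed (simp add: Inv_def)
  then show ?thesis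
    by (rule halts_within_mono) (use assms in \<open>auto simp: Inv_def\<close>)
qed

text \<open>The guards of the program mirror those of \<open>move\<close>, and the record is updated
  in place, its key according to \<open>key_assign\<close> or \<open>key_next\<close>.\<close>

lemma move_prog:
  assumes "params f" "input_mem M" "table_start \<le> f 5" "f 6 \<le> n" "represents M (f 5) s" "valid s"
  shows "halts_within (move_prog K) (f, M) (3 * K + 7)
    (\<lambda>(f', M'). f' = f \<and> (\<forall>a<f 5. M' a = M a) \<and> represents M' (f 5) (move (f 6) s))"
proof -
  obtain c a where s: "s = (c, a)" by (cases s)
  define q where "q = f 5"
  have key: "M (q + x) = key (c, a) x" if "x < key_len K" for x
    using assms(5) that by (simp add: represents_def s q_def)
  have arr: "M (q + key_len K + j) = a j" if "j < n" for j
    using assms(5) that by (simp add: represents_def s q_def)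
  have c: "M q = c" "c \<noteq> 0" using key[of 0] key_len_pos assms(6) by (auto simp: key_simps s)
  let ?Q = "\<lambda>(f', M'). f' = f \<and> (\<forall>a<f 5. M' a = M a) \<and> represents M' (f 5) (move (f 6) s)"
  have f: "f 1 = n" "f 2 = m" using assms(1) by (auto simp: params_def)
  have off: "off_load K < off_cost K + 1" "off_cost K \<le> key_len K" "off_load K > 0" "off_cost K = off_load K + K" "key_len K = off_cost K + K"
    by (auto simp: off_load_def off_cost_def key_len_def)

  have assign: "halts_within (assign_prog K) (f, M) (1 + (1 + (K * (1 + (1 + 1)) + 1))) ?Q" if j: "f 6 < n" "a (f 6) = 0"
  proof -
    define j where "j = f 6"
    have t: "Suc (job_type j) < off_load K" using job_type_less[of j] by (simp add: off_load_def)
    \<comment> \<open>\<open>M0\<close> is the memory after the two unconditional stores.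
      \<open>Inv k\<close> adds the effect of the first k scenarios in terms of the original
      \<open>M\<close>; in a cost cell, \<open>M (a - K)\<close> is the load before the move, hence
      the + 1.\<close>
    define M0 where "M0 = M(q + key_len K + j := c, q + Suc (job_type j) := Suc (M (q + Suc (job_type j))))"
    define Inv where "Inv k s \<longleftrightarrow> fst s = f \<and> (\<forall>a. snd s a =
        (if q + off_load K \<le> a \<and> a < q + off_load K + k then M a + inc (a - q - off_load K) j
         else if q + off_cost K \<le> a \<and> a < q + off_cost K + k
           then M a + inc (a - q - off_cost K) j * (M (a - K) + 1)
         else M0 a))" for k s
    have eq: "\<And>g. Inv k (g, N) \<Longrightarrow> k < K \<Longrightarrow> eval_exp (inc_exp k) (g, N) = inc k j" for k N
    proof -
      fix g assume I: "Inv k (g, N)" "k < K"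
      then have g: "g = f" by (simp add: Inv_def)
      have "input_mem N"
        by (rule input_mem_cong[OF _ assms(2)]) (use I assms(3) off q_def in \<open>auto simp: Inv_def M0_def\<close>)
      then show "eval_exp (inc_exp k) (g, N) = inc k j"
        unfolding g j_def by (rule eval_inc_exp) (use assms(1) j I in auto)
    qed
    have "halts_within (assign_prog K) (f, M) (1 + (1 + (K * (1 + (1 + 1)) + 1))) (Inv K)"
      unfolding assign_prog_def add_to_def
    proof (intro halts_within_SeqI halts_within_Store halts_within_seqs, goal_cases)
      case (1 k g N)
      have e: "eval_exp (inc_exp k) (g, N) = inc k j" using eq 1 by simp
      show ?case
      proof (rule halts_within_Cond, unfold e, goal_cases)
        case 1
        then have "inc k j = 1" using inc_le[of k j] by simp
        define u v where "u = q + off_load K + k" and "v = q + off_cost K + k"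
        have g: "g = f" and N: "N a = (if q + off_load K \<le> a \<and> a < u then M a + inc (a - q - off_load K) j
            else if q + off_cost K \<le> a \<and> a < v then M a + inc (a - q - off_cost K) j * (M (a - K) + 1)
            else M0 a)" for a
          using \<open>Inv k (g, N)\<close> unfolding Inv_def u_def v_def fst_conv snd_conv by blast+
        have uv: "u < q + off_cost K" "q + off_cost K \<le> v" "v < q + key_len K" "v - K = u" "q + Suc (job_type j) < q + off_load K" "q + off_load K \<le> u"
          "u - q - off_load K = k" "v - q - off_cost K = k"
          using \<open>k < K\<close> off t by (auto simp: u_def v_def)
        \<comment> \<open>The load and cost cells of scenario k are touched neither by earlier
          scenarios nor by the two initial stores.\<close>
        have Nuv: "N u = M u" "N v = M v" using uv by (auto simp: N M0_def)
        have "(N(u := Suc (M u), v := M v + Suc (M u))) a = (if q + off_load K \<le> a \<and> a < Suc u then M a + inc (a - q - off_load K) j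
            else if q + off_cost K \<le> a \<and> a < Suc v then M a + inc (a - q - off_cost K) j * (M (a - K) + 1)
            else M0 a)" for a
        proof -
          consider "a = u" | "a = v" | "a \<noteq> u" "a \<noteq> v" by auto
          then show ?thesis
          proof cases
            case 3
            then have "a < Suc u \<longleftrightarrow> a < u" "a < Suc v \<longleftrightarrow> a < v" by auto
            then show ?thesis using 3 by (simp add: N)
          qed (use uv \<open>inc k j = 1\<close> in auto)
        qed
        then have "Inv (Suc k) (g, N(u := Suc (M u), v := M v + Suc (M u)))"
          by (simp add: Inv_def g u_def v_def)
        then show ?case
          by (intro halts_within_SeqI halts_within_Store)
            (use Nuv uv in \<open>auto simp: g u_def v_def q_def[symmetric] add.assoc\<close>)
      next
        case 2
        show ?case
          by (rule halts_within_Skip)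
            (use 2 \<open>Inv k (g, N)\<close> \<open>k < K\<close> off t in \<open>auto simp: Inv_def M0_def q_def less_Suc_eq\<close>)
      qed
    next
      case 2
      have "eval_exp (type_exp K) (f, M(q + key_len K + j := c)) = job_type (f 6)"
        by (rule eval_type_exp[OF input_mem_cong[OF _ assms(2)] assms(1) j(1)])
          (use assms(3) in \<open>auto simp: q_def\<close>)
      then show ?case
        using c off t by (auto simp: Inv_def M0_def q_def[symmetric] j_def[symmetric] add.assoc[symmetric])
    qed
    then show ?thesis
    proof (rule halts_within_mono, goal_cases)
      case (2 s')
      then obtain g N where s': "s' = (g, N)" "Inv K (g, N)" by (cases s') auto
      have "N (q + x) = key_assign j (key (c, a)) x" if x: "x < key_len K" for x
      proof -
        have "M (q + x) = key (c, a) x" "off_cost K \<le> x \<Longrightarrow> M (q + x - K) = key (c, a) (x - K)"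
          using key[of x] key[of "x - K"] x off by auto
        then show ?thesis using s'(2) x off t by (auto simp: Inv_def M0_def key_assign_def)
      qed
      moreover have "N (q + key_len K + j') = (a(j := c)) j'" if "j' < n" for j'
        using s'(2) arr[OF that] off t by (auto simp: Inv_def M0_def)
      moreover have "g = f" "\<forall>a<q. N a = M a" using s'(2) off by (auto simp: Inv_def M0_def)
      moreover have "move (f 6) s = (c, a(j := c))" using j by (simp add: s j_def)
      ultimately show ?case
        using s'(1) j c key_assign[of j a c] by (simp add: represents_def q_def j_def)
    qed simp
  qed
  have next_step: "halts_within (next_prog K) (f, M) (1 + (K * 1 + 1)) ?Q" if j: "f 6 = n" "c < m" "c < n"
  proof -
    define Inv where "Inv k s \<longleftrightarrow> fst s = f \<and> (\<forall>a. snd s a =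
        (if q + off_load K \<le> a \<and> a < q + off_load K + k then 0 else if a = q then Suc c else M a))" for k s
    have "halts_within (next_prog K) (f, M) (1 + (K * 1 + 1)) (Inv K)"
      unfolding next_prog_def add_to_def
    proof (intro halts_within_SeqI halts_within_Store halts_within_seqs, goal_cases)
      case (1 k g N)
      then show ?case using off by (auto simp: Inv_def q_def less_Suc_eq)
    next
      case 2
      then show ?case using off c by (auto simp: Inv_def q_def)
    qed
    then show ?thesis
    proof (rule halts_within_mono, goal_cases)
      case (2 s')
      then obtain g N where s': "s' = (g, N)" "Inv K (g, N)" by (cases s') auto
      have "N (q + x) = key_next (key (c, a)) x" if x: "x < key_len K" for x
        using s'(2) x off key[of x] key[of 0] c key_len_pos by (auto simp: Inv_def key_next_def)
      moreover have "N (q + key_len K + j') = a j'" if "j' < n" for j'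
        using s'(2) arr[OF that] off by (auto simp: Inv_def)
      moreover have "\<And>j. j < n \<Longrightarrow> a j \<le> c" using assms(6) s by simp
      moreover have "g = f" "\<forall>a<q. N a = M a" using s'(2) off by (auto simp: Inv_def)
      moreover have "move (f 6) s = (Suc c, a)" using j by (simp add: s)
      ultimately show ?case
        using s'(1) key_next[of a c] by (simp add: represents_def q_def)
    qed simp
  qed
  have "halts_within (move_prog K) (f, M) (1 + (1 + (1 + (3 * K + 4)))) ?Q"
    unfolding move_prog_def
  proof (intro halts_within_Cond, goal_cases)
    case 1
    then show ?case using assms f arr[of "f 6"]
      by (intro halts_within_Skip) (auto simp: s q_def)
  next
    case 2
    then show ?case using f arr[of "f 6"]
      by (intro halts_within_mono[OF assign]) (auto simp: q_def)
  next
    case 3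
    then show ?case using f c assms(4)
      by (intro halts_within_mono[OF next_step]) (auto simp: q_def)
  next
    case 4
    then have "move (f 6) s = s" using f c by (simp add: s q_def)
    with assms(5) show ?case by (simp add: halts_within_Skip)
  next
    case 5
    then have "move (f 6) s = s" using f c by (simp add: s q_def)
    with assms(5) show ?case by (simp add: halts_within_Skip)
  qed
  then show ?thesis by (rule halts_within_mono) auto
qed

lemma keys_eq_iff_represents:
  assumes "represents M u s" "represents M u' s'"
  shows "keys s = keys s' \<longleftrightarrow> (\<forall>x<key_len K. M (u + x) = M (u' + x))"
  using assms by (auto simp: keys_eq_iff represents_def)

lemma eval_differ_exp:
  "eval_exp (differ_exp K) (f, M) = 0 \<longleftrightarrow> (\<forall>x<key_len K. M (f 7 + x) = M (f 5 + x))"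
  by (auto simp: differ_exp_def eval_sum_exp sum_list_eq_0_iff intro!: le_antisym)

lemma record_len_pos: "record_len > 0"
  using key_len_pos by (simp add: record_len_def)

definition insert_key :: "nat \<times> (nat \<Rightarrow> nat) \<Rightarrow> (nat \<times> (nat \<Rightarrow> nat)) list \<Rightarrow> (nat \<times> (nat \<Rightarrow> nat)) list" where
  "insert_key s rs = (if keys s \<in> keys ` set rs then rs else rs @ [s])"

lemma insert_prog:
  assumes "params f" "table M rs" "represents M (f 5) s" "f 5 = table_start + length rs * record_len"
  shows "halts_within (insert_prog K) (f, M) (2 * length rs + 4)
    (\<lambda>(f', M'). M' = M \<and> (\<exists>y. f' = f(7 := y, 5 := table_start + length (insert_key s rs) * record_len)))"
    (is "halts_within _ _ _ ?Q")
proof -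
  let ?N = "length rs"
  define Inv where "Inv i t \<longleftrightarrow> t = (f(7 := table_start + i * record_len), M) \<and> i \<le> ?N \<and>
      (\<forall>i'<i. keys (rs ! i') \<noteq> keys s)" for i t
  have f: "f 0 = table_start" "f 3 = record_len" using assms(1) by (auto simp: params_def)
  have rep: "represents M (table_start + i * record_len) (rs ! i)" if "i < ?N" for i
    using assms(2) that by (simp add: table_def)
  \<comment> \<open>At position \<open>?N\<close> the new record is compared with itself, so the
    guard fails there at the latest.\<close>
  have diff: "eval_exp (differ_exp K) (g, L) = 0 \<longleftrightarrow> i = ?N \<or> keys (rs ! i) = keys s" if "Inv i (g, L)" for i g L
  proof (cases "i = ?N")
    case True
    then show ?thesis using that assms(4) by (simp add: eval_differ_exp Inv_def)
  next
    case False
    then have "i < ?N" using that by (simp add: Inv_def)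
    from keys_eq_iff_represents[OF rep[OF this] assms(3)] False that show ?thesis
      by (simp add: eval_differ_exp Inv_def)
  qed
  have "halts_within (insert_prog K) (f, M) (1 + ((?N * (1 + 1) + 1) + (1 + 1))) ?Q"
    unfolding insert_prog_def
  proof (rule halts_within_SeqI, rule halts_within_Assign, rule halts_within_Seq, rule halts_within_While[where Inv = Inv], goal_cases)
    case (1 i g L)
    then have i: "i < ?N" "keys (rs ! i) \<noteq> keys s" using diff[OF 1(1)] by (auto simp: Inv_def)
    show ?case
      by (intro conjI i halts_within_Assign) (use 1 i f in \<open>auto simp: Inv_def less_Suc_eq\<close>)
  next
    case 2
    show ?case using f by (simp add: Inv_def)
  next
    case (3 g L)
    then obtain i where i: "Inv i (g, L)" "i = ?N \<or> keys (rs ! i) = keys s"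
      using diff by blast
    have "g 5 - g 7 = 0 \<longleftrightarrow> i = ?N"
      using i(1) assms(4) record_len_pos by (auto simp: Inv_def)
    moreover have "keys s \<in> keys ` set rs \<longleftrightarrow> i \<noteq> ?N"
    proof (cases "i = ?N")
      case True
      then have "\<forall>r\<in>set rs. keys r \<noteq> keys s" using i(1) by (metis Inv_def in_set_conv_nth)
      then show ?thesis using True by force
    next
      case False
      then have "i < ?N" "keys (rs ! i) = keys s" using i by (auto simp: Inv_def)
      then show ?thesis by (metis False image_eqI nth_mem)
    qed
    ultimately show ?case
      using i(1) f assms(4)
      by (intro halts_within_Cond halts_within_Skip halts_within_Assign)
        (auto simp: Inv_def insert_key_def fun_upd_twist intro!: exI)
  qed
  then show ?thesis by (rule halts_within_mono) auto
qed

section \<open>Invariants of the closure computation\<close>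

definition mem_inv :: "(nat \<times> (nat \<Rightarrow> nat)) list \<Rightarrow> nat \<Rightarrow> nat \<Rightarrow> ram_state \<Rightarrow> bool" where
  "mem_inv rs i j s \<longleftrightarrow> params (fst s) \<and> input_mem (snd s) \<and> table (snd s) rs \<and>
     fst s 5 = table_start + length rs * record_len \<and> fst s 4 = table_start + i * record_len \<and> fst s 6 = j
     \<and> fst s 8 = table_start"

definition table_ok :: "(nat \<times> (nat \<Rightarrow> nat)) list \<Rightarrow> bool" where
  "table_ok rs \<longleftrightarrow> (1, \<lambda>_. 0) \<in> set rs \<and> (\<forall>s\<in>set rs. valid s) \<and> distinct (map keys rs)"

lemma table_ok_insert_key: "table_ok rs \<Longrightarrow> valid s \<Longrightarrow> table_ok (insert_key s rs)"
  by (auto simp: table_ok_def insert_key_def)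

lemma table_insert_key:
  assumes "table M rs" "represents M (table_start + length rs * record_len) s"
  shows "table M (insert_key s rs)"
  using assms by (auto simp: table_def insert_key_def nth_append less_Suc_eq)

definition max_records :: nat where "max_records = ((n + 1) ^ 3 + 1) ^ key_len K"

lemma length_le_max_records: "table_ok rs \<Longrightarrow> length rs \<le> max_records"
  unfolding table_ok_def max_records_def by (intro length_le_if_distinct_keys) auto

definition body_time :: nat where
  "body_time = 3 * record_len + 2 + (3 * K + 7 + (2 * max_records + 4 + 1))"

lemma expand_body:
  assumes "mem_inv rs i j (f, M)" "table_ok rs" "i < length rs" "j \<le> n"
  shows "halts_within (Seq copy_prog (Seq (move_prog K) (Seq (insert_prog K) (Assign 6 (Plus (Reg 6) (Const 1))))))
    (f, M) body_time (mem_inv (insert_key (move j (rs ! i)) rs) i (Suc j))"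
  unfolding body_time_def
proof (rule halts_within_Seq[OF copy_prog])
  have inv: "params f" "input_mem M" "table M rs" "f 5 = table_start + length rs * record_len"
      "f 4 = table_start + i * record_len" "f 6 = j" "f 8 = table_start"
    using assms(1) by (auto simp: mem_inv_def)
  have "Suc i * record_len \<le> length rs * record_len" using assms(3) by (intro mult_le_mono1) simp
  then show "f 4 + record_len \<le> f 5" using inv by simp
  show "f 3 = record_len" using inv by (simp add: params_def)
  have valid: "valid (rs ! i)" using assms(2,3) by (simp add: table_ok_def)
  fix f1 M1
  assume "case (f1, M1) of (f', M') \<Rightarrow> f' = f(7 := record_len) \<and> (\<forall>a<f 5. M' a = M a) \<and>
    (\<forall>x<record_len. M' (f 5 + x) = M (f 4 + x))"
  then have f1: "f1 = f(7 := record_len)" and M1: "\<And>a. a < f 5 \<Longrightarrow> M1 a = M a"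
    "\<And>x. x < record_len \<Longrightarrow> M1 (f 5 + x) = M (f 4 + x)" by auto
  have p1: "params f1" using inv by (simp add: params_def f1)
  have i1: "input_mem M1" by (rule input_mem_cong[OF M1(1) inv(2)]) (use inv in auto)
  have t1: "table M1 rs" by (rule table_cong[OF M1(1) inv(3)]) (use inv in auto)
  have "represents M (f 4) (rs ! i)" using inv assms(3) by (simp add: table_def)
  from represents_cong[OF _ this, of M1 "f1 5"] have r1: "represents M1 (f1 5) (rs ! i)"
    using M1(2) by (simp add: f1)
  show "halts_within (Seq (move_prog K) (Seq (insert_prog K) (Assign 6 (Plus (Reg 6) (Const 1)))))
    (f1, M1) (3 * K + 7 + (2 * max_records + 4 + 1)) (mem_inv (insert_key (move j (rs ! i)) rs) i (Suc j))"
  proof (rule halts_within_Seq[OF move_prog[OF p1 i1 _ _ r1 valid]])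
    show "table_start \<le> f1 5" "f1 6 \<le> n" using inv assms(4) by (auto simp: f1)
    fix f2 M2
    assume "case (f2, M2) of (f', M') \<Rightarrow> f' = f1 \<and> (\<forall>a<f1 5. M' a = M1 a) \<and> represents M' (f1 5) (move (f1 6) (rs ! i))"
    then have f2: "f2 = f1" and M2: "\<And>a. a < f1 5 \<Longrightarrow> M2 a = M1 a" and r2: "represents M2 (f2 5) (move j (rs ! i))"
      using inv by (auto simp: f1)
    have i2: "input_mem M2" by (rule input_mem_cong[OF M2 i1]) (use inv in \<open>auto simp: f1\<close>)
    have t2: "table M2 rs" by (rule table_cong[OF M2 t1]) (use inv in \<open>auto simp: f1\<close>)
    have len: "f2 5 = table_start + length rs * record_len" using inv by (simp add: f1 f2)
    show "halts_within (Seq (insert_prog K) (Assign 6 (Plus (Reg 6) (Const 1))))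
      (f2, M2) (2 * max_records + 4 + 1) (mem_inv (insert_key (move j (rs ! i)) rs) i (Suc j))"
    proof (rule halts_within_Seq)
      show "halts_within (insert_prog K) (f2, M2) (2 * max_records + 4) (\<lambda>(f', M'). M' = M2 \<and> (\<exists>y. f' =
          f2(7 := y, 5 := table_start + length (insert_key (move j (rs ! i)) rs) * record_len)))"
        by (rule halts_within_mono[OF insert_prog[where f = f2, OF _ t2 r2 len]])
          (use p1 f2 length_le_max_records[OF assms(2)] in auto)
      fix f3 M3
      assume "case (f3, M3) of (f', M') \<Rightarrow> M' = M2 \<and> (\<exists>y. f' =
          f2(7 := y, 5 := table_start + length (insert_key (move j (rs ! i)) rs) * record_len))"
      then obtain y where 3: "M3 = M2" "f3 = f2(7 := y, 5 := table_start + length (insert_key (move j (rs ! i)) rs) * record_len)"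
        by auto
      show "halts_within (Assign 6 (Plus (Reg 6) (Const 1))) (f3, M3) 1 (mem_inv (insert_key (move j (rs ! i)) rs) i (Suc j))"
        by (rule halts_within_Assign)
          (use 3 i2 inv p1 table_insert_key[OF t2, of "move j (rs ! i)"] r2 len in
            \<open>simp add: mem_inv_def params_def f1 f2\<close>)
    qed
  qed
qed

definition closed_upto :: "(nat \<times> (nat \<Rightarrow> nat)) list \<Rightarrow> nat \<Rightarrow> nat \<Rightarrow> bool" where
  "closed_upto rs i j \<longleftrightarrow> (\<forall>i'\<le>i. \<forall>j'\<le>n. i' < i \<or> j' < j \<longrightarrow> keys (move j' (rs ! i')) \<in> keys ` set rs)"

text \<open>Records are only appended: positions up to i keep their entries, and keys found earlier
  remain in the table.\<close>

lemma closed_upto_insert_key: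
  assumes "closed_upto rs i j" "i < length rs"
  shows "closed_upto (insert_key (move j (rs ! i)) rs) i (Suc j)"
proof -
  let ?rs = "insert_key (move j (rs ! i)) rs"
  have nth: "?rs ! i' = rs ! i'" if "i' \<le> i" for i'
    using that assms(2) by (simp add: insert_key_def nth_append)
  have "keys ` set rs \<subseteq> keys ` set ?rs" "keys (move j (rs ! i)) \<in> keys ` set ?rs"
    by (auto simp: insert_key_def)
  with assms(1) show ?thesis
    unfolding closed_upto_def by (auto simp: nth less_Suc_eq le_less)
qed

definition loop_inv :: "nat \<Rightarrow> nat \<Rightarrow> ram_state \<Rightarrow> bool" where
  "loop_inv i j s \<longleftrightarrow> (\<exists>rs. mem_inv rs i j s \<and> table_ok rs \<and> i < length rs \<and> j \<le> Suc n \<and> closed_upto rs i j)"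

text \<open>Between expansions the job register holds a leftover value, so \<open>mem_inv\<close> is
  taken at whatever it contains.\<close>

definition outer_inv :: "nat \<Rightarrow> ram_state \<Rightarrow> bool" where
  "outer_inv i s \<longleftrightarrow> (\<exists>rs. mem_inv rs i (fst s 6) s \<and> table_ok rs \<and> i \<le> length rs \<and> closed_upto rs i 0)"

definition expand_time :: nat where
  "expand_time = 1 + ((n + 1) * (body_time + 1) + 1 + 1)"

lemma expand_prog:
  assumes "outer_inv i (f, M)" "f 5 - f 4 \<noteq> 0"
  shows "halts_within (expand_prog K) (f, M) expand_time (outer_inv (Suc i))"
  unfolding expand_prog_def expand_time_def
proof (rule halts_within_SeqI, rule halts_within_Assign, rule halts_within_Seq, rule halts_within_While[where Inv = "loop_inv i"], goal_cases)
  case (1 j g L)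
  then obtain rs where rs: "mem_inv rs i j (g, L)" "table_ok rs" "i < length rs" "j \<le> Suc n" "closed_upto rs i j"
    by (auto simp: loop_inv_def)
  then have j: "j \<le> n" using 1(2) by (simp add: mem_inv_def params_def)
  have "valid (move j (rs ! i))" using rs by (intro valid_move) (simp add: table_ok_def)
  then have "table_ok (insert_key (move j (rs ! i)) rs)" by (rule table_ok_insert_key[OF rs(2)])
  moreover have "i < length (insert_key (move j (rs ! i)) rs)" using rs(3) by (simp add: insert_key_def)
  ultimately have "halts_within (Seq copy_prog (Seq (move_prog K) (Seq (insert_prog K) (Assign 6 (Plus (Reg 6) (Const 1))))))
    (g, L) body_time (loop_inv i (Suc j))"
    by (intro halts_within_mono[OF expand_body[OF rs(1,2,3) j]])
      (use j closed_upto_insert_key[OF rs(5,3)] in \<open>auto simp: loop_inv_def\<close>)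
  with j show ?case by simp
next
  case 2
  obtain rs where rs: "mem_inv rs i (f 6) (f, M)" "table_ok rs" "closed_upto rs i 0"
    using assms(1) by (auto simp: outer_inv_def)
  have "i < length rs"
  proof (rule ccontr)
    assume "\<not> i < length rs"
    then have "length rs * record_len \<le> i * record_len" by (intro mult_le_mono1) simp
    with rs(1) assms(2) show False by (simp add: mem_inv_def)
  qed
  with rs show ?case by (auto simp: loop_inv_def mem_inv_def params_def)
next
  case (3 g L)
  then obtain j rs where rs: "mem_inv rs i j (g, L)" "table_ok rs" "i < length rs" "j \<le> Suc n" "closed_upto rs i j"
      "g 1 + 1 - g 6 = 0"
    by (auto simp: loop_inv_def)
  then have "j = Suc n" by (simp add: mem_inv_def params_def)
  with rs(5) have "closed_upto rs (Suc i) 0" by (auto simp: closed_upto_def le_Suc_eq)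
  moreover have "mem_inv rs (Suc i) j (g(4 := eval_exp (Plus (Reg 4) (Reg 3)) (g, L)), L)"
    using rs(1) by (simp add: mem_inv_def params_def)
  ultimately show ?case
    using rs by (intro halts_within_Assign) (auto simp: outer_inv_def mem_inv_def)
qed

definition search_done :: "nat \<Rightarrow> (nat \<times> (nat \<Rightarrow> nat)) list \<Rightarrow> ram_state \<Rightarrow> bool" where
  "search_done i rs s \<longleftrightarrow> mem_inv rs i (fst s 6) s \<and> table_ok rs \<and> closed rs"

text \<open>The table may grow while the loop runs, but iteration i requires i <
  \<open>length rs\<close>, and distinct keys keep this length within \<open>max_records\<close>. On
  exit every position has been expanded, so the table is closed.\<close>

lemma search_loop:
  assumes "outer_inv 0 s"
  shows "halts_within (While (Minus (Reg 5) (Reg 4)) (expand_prog K)) s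
    (max_records * (expand_time + 1) + 1) (\<lambda>s. \<exists>i rs. search_done i rs s)"
proof (rule halts_within_mono[OF halts_within_While[where Inv = outer_inv]])
  fix i f M
  assume *: "outer_inv i (f, M)" "eval_exp (Minus (Reg 5) (Reg 4)) (f, M) \<noteq> 0"
  then obtain rs where rs: "mem_inv rs i (f 6) (f, M)" "table_ok rs" by (auto simp: outer_inv_def)
  have "i < length rs"
  proof (rule ccontr)
    assume "\<not> i < length rs"
    then have "length rs * record_len \<le> i * record_len" by (intro mult_le_mono1) simp
    with rs(1) *(2) show False by (simp add: mem_inv_def)
  qed
  with length_le_max_records[OF rs(2)] expand_prog[OF *(1)] *(2)
  show "i < max_records \<and> halts_within (expand_prog K) (f, M) expand_time (outer_inv (Suc i))"
    by simp
next
  fix s assume "\<exists>i. outer_inv i s \<and> eval_exp (Minus (Reg 5) (Reg 4)) s = 0"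
  then obtain i rs where rs: "mem_inv rs i (fst s 6) s" "table_ok rs" "i \<le> length rs" "closed_upto rs i 0"
    and "fst s 5 - fst s 4 = 0" by (auto simp: outer_inv_def)
  then have "length rs * record_len \<le> i * record_len" by (simp add: mem_inv_def)
  then have "length rs = i" using rs(3) record_len_pos by simp
  have "closed rs"
    unfolding closed_def
  proof (intro ballI allI impI)
    fix r j assume "r \<in> set rs" "j \<le> n"
    then obtain i' where "i' < i" "r = rs ! i'" using \<open>length rs = i\<close> by (metis in_set_conv_nth)
    with rs(4) \<open>j \<le> n\<close> show "keys (move j r) \<in> keys ` set rs" by (simp add: closed_upto_def)
  qed
  with rs show "\<exists>i rs. search_done i rs s" by (auto simp: search_done_def)
qed (use assms in auto)

section \<open>Selection and output of the best complete record\<close>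

definition full :: "(nat \<Rightarrow> nat) \<Rightarrow> bool" where
  "full a \<longleftrightarrow> (\<forall>j<n. a j \<noteq> 0)"

lemma full_iff: "full a \<longleftrightarrow> n - (\<Sum>t<2 ^ K. count a t) = 0"
proof -
  have sub: "{j. j < n \<and> a j \<noteq> 0} \<subseteq> {..<n}" by auto
  show ?thesis
  proof
    assume "full a"
    then have "{j. j < n \<and> a j \<noteq> 0} = {..<n}" by (auto simp: full_def)
    then show "n - (\<Sum>t<2 ^ K. count a t) = 0" unfolding sum_count by (metis card_lessThan diff_self_eq_0)
  next
    assume "n - (\<Sum>t<2 ^ K. count a t) = 0"
    then have "card {..<n} \<le> card {j. j < n \<and> a j \<noteq> 0}" unfolding sum_count by simp
    from card_seteq[OF _ sub this] show "full a" by (auto simp: full_def)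
  qed
qed

fun costs :: "nat \<times> (nat \<Rightarrow> nat) \<Rightarrow> nat list" where
  "costs (c, a) = map (cost c a) [0..<K]"

lemma key_offsets:
  "t < 2 ^ K \<Longrightarrow> Suc t < key_len K"
  "k < K \<Longrightarrow> off_cost K + k < key_len K"
  by (auto simp: key_len_def off_cost_def off_load_def)

text \<open>Together with the same fact for costs, this lets optimality among representatives carry
  over to all valid states.\<close>

lemma keys_eq_full:
  assumes "keys s = keys s'"
  shows "full (snd s) = full (snd s')"
proof -
  obtain c a c' a' where s: "s = (c, a)" "s' = (c', a')" by (cases s; cases s')
  have "count a t = count a' t" if "t < 2 ^ K" for t
    using assms key_offsets(1)[OF that] key_simps(2)[OF that] by (metis keys_eq_iff s)
  then show ?thesis by (simp add: s full_iff)
qed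

lemma keys_eq_costs:
  assumes "keys s = keys s'"
  shows "costs s = costs s'"
proof -
  obtain c a c' a' where s: "s = (c, a)" "s' = (c', a')" by (cases s; cases s')
  have "cost c a k = cost c' a' k" if "k < K" for k
    using assms key_offsets(2)[OF that] key_simps(4) by (metis keys_eq_iff s)
  then show ?thesis by (simp add: s)
qed

lemma eval_unassigned_exp:
  assumes "represents M (f r) s" "params f"
  shows "eval_exp (unassigned_exp K r) (f, M) = 0 \<longleftrightarrow> full (snd s)"
proof -
  obtain c a where s: "s = (c, a)" by (cases s)
  have "M (f r + Suc t) = count a t" if "t < 2 ^ K" for t
    using assms(1) key_offsets(1)[OF that] key_simps(2)[OF that] unfolding represents_def s by metis
  then have "(\<Sum>t<2 ^ K. M (f r + Suc t)) = (\<Sum>t<2 ^ K. count a t)" by simp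
  then show ?thesis
    using assms(2) by (simp add: unassigned_exp_def eval_sum_exp o_def params_def s full_iff
      interv_sum_list_conv_sum_set_nat atLeast0LessThan)
qed

lemma eval_costs_exp:
  assumes "represents M (f r) s"
  shows "map (\<lambda>e. eval_exp e (f, M)) (costs_exp K r) = costs s"
proof -
  obtain c a where s: "s = (c, a)" by (cases s)
  have "M (f r + (off_cost K + k)) = cost c a k" if "k < K" for k
    using assms key_offsets(2)[OF that] key_simps(4) by (simp add: represents_def s)
  then show ?thesis by (simp add: costs_exp_def s)
qed

text \<open>If no record is complete, the claim about \<open>b\<close> is vacuous; this is what
  makes position 0 a correct initial choice.\<close>

lemma best_prog:
  assumes g: "\<And>es s. eval_exp (g es) s = G (map (\<lambda>e. eval_exp e s) es)"
    and "params f" "table M rs" "f 5 = table_start + length rs * record_len" "f 8 = table_start" "rs \<noteq> []"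
  shows "halts_within (best_prog g K) (f, M) (6 * length rs + 2)
    (\<lambda>(f', M'). M' = M \<and> params f' \<and> (\<exists>b<length rs. f' 8 = table_start + b * record_len \<and>
      (\<forall>i<length rs. full (snd (rs ! i)) \<longrightarrow> full (snd (rs ! b)) \<and> G (costs (rs ! b)) \<le> G (costs (rs ! i)))))"
proof -
  let ?N = "length rs"
  define Inv where "Inv i s \<longleftrightarrow> snd s = M \<and> params (fst s) \<and> fst s 5 = f 5 \<and> i \<le> ?N \<and>
      fst s 4 = table_start + i * record_len \<and> (\<exists>b<?N. fst s 8 = table_start + b * record_len \<and>
        (\<forall>i'<i. full (snd (rs ! i')) \<longrightarrow> full (snd (rs ! b)) \<and> G (costs (rs ! b)) \<le> G (costs (rs ! i'))))" for i s
  have "halts_within (best_prog g K) (f, M) (1 + (?N * ((1 + (1 + (1 + 1)) + 1) + 1) + 1))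
    (\<lambda>s. \<exists>i. Inv i s \<and> eval_exp (Minus (Reg 5) (Reg 4)) s = 0)"
    unfolding best_prog_def
  proof (rule halts_within_SeqI, rule halts_within_Assign, rule halts_within_While, goal_cases)
    case (1 i h L)
    then obtain b where b: "b < ?N" "h 8 = table_start + b * record_len"
      "\<And>i'. i' < i \<Longrightarrow> full (snd (rs ! i')) \<Longrightarrow> full (snd (rs ! b)) \<and> G (costs (rs ! b)) \<le> G (costs (rs ! i'))"
      by (auto simp: Inv_def)
    have inv: "L = M" "params h" "h 5 = f 5" "i \<le> ?N" "h 4 = table_start + i * record_len"
      using 1(1) by (auto simp: Inv_def)
    have i: "i < ?N" using 1(2) inv assms(4) by (cases "i = ?N") auto
    have r4: "represents L (h 4) (rs ! i)" and r8: "represents L (h 8) (rs ! b)"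
      using inv b i assms(3) by (auto simp: table_def)
    note eval = eval_unassigned_exp[where r = 4, OF r4 inv(2)] eval_unassigned_exp[where r = 8, OF r8 inv(2)] g
      eval_costs_exp[where f = h and r = 4, OF r4] eval_costs_exp[where f = h and r = 8, OF r8]
    define better where "better b' \<longleftrightarrow> b' < ?N \<and>
      (\<forall>i'<Suc i. full (snd (rs ! i')) \<longrightarrow> full (snd (rs ! b')) \<and> G (costs (rs ! b')) \<le> G (costs (rs ! i')))" for b'
    have keep: "better b \<Longrightarrow> Inv (Suc i) (h(4 := h 4 + h 3), L)"
      and change: "better i \<Longrightarrow> Inv (Suc i) (h(8 := h 4, 4 := h 4 + h 3), L)"
      using inv i b(2) by (auto simp: Inv_def better_def params_def)
    show ?case
    proof (rule conjI[OF i], rule halts_within_SeqI, intro halts_within_Cond halts_within_Skip halts_within_Assign, goal_cases)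
      case 1
      then have "better b" using b by (auto simp: better_def eval less_Suc_eq)
      with keep show ?case by simp
    next
      case 3
      then have "better i" using b i by (auto simp: better_def eval less_Suc_eq)
      then have "halts_within (Assign 8 (Reg 4)) (h, L) 1
          (\<lambda>s. halts_within (Assign 4 (Plus (Reg 4) (Reg 3))) s 1 (Inv (Suc i)))"
        using change by (intro halts_within_Assign) simp
      then show ?case by (rule halts_within_mono) auto
    next
      case 4
      then have *: "full (snd (rs ! b))" "full (snd (rs ! i))" "G (costs (rs ! i)) < G (costs (rs ! b))"
        by (auto simp: eval)
      have "better i" using b i * by (fastforce simp: better_def less_Suc_eq)
      with change show ?case by simp
    next
      case 5
      then have *: "full (snd (rs ! b))" "full (snd (rs ! i))" "G (costs (rs ! b)) \<le> G (costs (rs ! i))"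
        by (auto simp: eval)
      have "better b" using b i * by (auto simp: better_def less_Suc_eq)
      with keep show ?case by simp
    qed simp_all
  next
    case 2
    then show ?case using assms by (auto simp: Inv_def params_def intro!: exI[of _ 0])
  qed
  then show ?thesis
  proof (rule halts_within_mono, goal_cases)
    case (2 s)
    then obtain i h L where s: "s = (h, L)" "Inv i (h, L)" "h 5 - h 4 = 0" by (cases s) auto
    then have "?N * record_len \<le> i * record_len" "i \<le> ?N" using assms(4) by (auto simp: Inv_def)
    then have "i = ?N" using record_len_pos by simp
    with s show ?case by (auto simp: Inv_def)
  qed simp
qed

text \<open>The n output cells lie inside the input area, before every record, so writing them never
  destroys a cell still to be read.\<close>

lemma output_prog:
  assumes "params f" "represents M (f 8) s" "table_start \<le> f 8"
  shows "halts_within (output_prog K) (f, M) (3 * n + 3) (\<lambda>s'. result_list s' = map (snd s) [0..<n])"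
proof -
  have n: "n \<le> f 8" using assms(3) by (simp add: table_start_def)
  have f: "f 1 = n" using assms(1) by (simp add: params_def)
  have arr: "M (f 8 + key_len K + j) = snd s j" if "j < n" for j
    using assms(2) that by (simp add: represents_def)
  define Inv where "Inv j s' \<longleftrightarrow> fst s' = f(6 := j) \<and> j \<le> n \<and>
      (\<forall>a. snd s' a = (if a < j then snd s a else M a))" for j s'
  have "halts_within (output_prog K) (f, M) (1 + ((n * ((1 + 1) + 1) + 1) + 1))
    (\<lambda>s'. result_list s' = map (snd s) [0..<n])"
    unfolding output_prog_def
  proof (rule halts_within_SeqI, rule halts_within_Assign, rule halts_within_Seq, rule halts_within_While[where Inv = Inv], goal_cases)
    case (1 j g L)
    then have j: "j < n" using f by (simp add: Inv_def)
    show ?case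
      by (intro conjI j halts_within_SeqI halts_within_Store halts_within_Assign)
        (use 1(1) j n arr in \<open>auto simp: Inv_def less_Suc_eq\<close>)
  next
    case (3 g L)
    then show ?case using f
      by (auto intro!: halts_within_Assign[unfolded One_nat_def] simp: result_list_def Inv_def)
  qed (simp add: Inv_def)
  then show ?thesis by (rule halts_within_mono) auto
qed

lemma init_prog:
  assumes "f = (\<lambda>_. 0)(0 := table_start)" "input_mem M" "\<And>a. table_start \<le> a \<Longrightarrow> M a = 0"
  shows "halts_within (init_prog K) (f, M) 7 (outer_inv 0)"
proof -
  define f' where "f' = f(1 := n, 2 := m, 3 := record_len, 4 := table_start, 5 := table_start + record_len, 8 := table_start)"
  define M' where "M' = M(table_start := 1)"
  have "key (1, \<lambda>_. 0) x = (if x = 0 then 1 else 0)" for x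
    by (simp add: key.simps count_def load_def cost_def)
  then have "represents M' table_start (1, \<lambda>_. 0)"
    using assms(3) key_len_pos by (auto simp: represents_def M'_def)
  then have t: "table M' [(1, \<lambda>_. 0)]" by (simp add: table_def)
  have i: "input_mem M'" by (rule input_mem_cong[OF _ assms(2)]) (simp add: M'_def)
  have "mem_inv [(1, \<lambda>_. 0)] 0 0 (f', M')"
    using t i by (simp add: mem_inv_def params_def f'_def assms(1))
  moreover have "table_ok [(1, \<lambda>_. 0)]" using machines by (simp add: table_ok_def)
  moreover have "f' 6 = 0" by (simp add: f'_def assms(1))
  ultimately have o: "outer_inv 0 (f', M')"
    unfolding outer_inv_def by (intro exI[of _ "[(1, \<lambda>_. 0)]"]) (auto simp: closed_upto_def)
  have "halts_within (init_prog K) (f, M) (1 + (1 + (1 + (1 + (1 + (1 + 1)))))) (outer_inv 0)"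
    unfolding init_prog_def
  proof (intro halts_within_SeqI halts_within_Assign halts_within_Store)
  qed (use o assms(1,2) in \<open>simp add: f'_def M'_def record_len_def input_mem_def\<close>)
  then show ?thesis by (rule halts_within_mono) auto
qed

definition total_time :: nat where
  "total_time = 7 + (max_records * (expand_time + 1) + 1 + (6 * max_records + 2 + (3 * n + 3)))"

lemma solver_correct:
  assumes g: "\<And>es s. eval_exp (g es) s = G (map (\<lambda>e. eval_exp e s) es)"
    and "f = (\<lambda>_. 0)(0 := table_start)" "input_mem M" "\<And>a. table_start \<le> a \<Longrightarrow> M a = 0"
  shows "halts_within (solver g K) (f, M) total_time
    (\<lambda>s. \<exists>c a. valid (c, a) \<and> full a \<and> result_list s = map a [0..<n] \<and>
      (\<forall>c' a'. valid (c', a') \<longrightarrow> full a' \<longrightarrow> G (costs (c, a)) \<le> G (costs (c', a'))))"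
  unfolding solver_def total_time_def
proof (rule halts_within_Seq[OF init_prog[OF assms(2-)]], assumption, rule halts_within_Seq[OF search_loop], assumption)
  fix f M assume "\<exists>i rs. search_done i rs (f, M)"
  then obtain i rs where rs: "mem_inv rs i (f 6) (f, M)" "table_ok rs" "closed rs"
    by (auto simp: search_done_def)
  have f: "params f" "table M rs" "f 5 = table_start + length rs * record_len" "f 8 = table_start"
    using rs(1) by (auto simp: mem_inv_def)
  have complete: "\<exists>i<length rs. keys (rs ! i) = keys s" if "valid s" for s
  proof -
    have "keys (fst s, snd s) \<in> keys ` set rs"
      by (rule closed_complete) (use rs that in \<open>auto simp: table_ok_def\<close>)
    then obtain r where "r \<in> set rs" "keys r = keys s" by force
    then show ?thesis by (metis in_set_conv_nth)
  qed
  have ne: "rs \<noteq> []" using rs(2) by (auto simp: table_ok_def)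
  show "halts_within (Seq (best_prog g K) (output_prog K)) (f, M) (6 * max_records + 2 + (3 * n + 3))
    (\<lambda>s. \<exists>c a. valid (c, a) \<and> full a \<and> result_list s = map a [0..<n] \<and>
      (\<forall>c' a'. valid (c', a') \<longrightarrow> full a' \<longrightarrow> G (costs (c, a)) \<le> G (costs (c', a'))))"
  proof (rule halts_within_Seq)
    show "halts_within (best_prog g K) (f, M) (6 * max_records + 2)
      (\<lambda>(f', M'). M' = M \<and> params f' \<and> (\<exists>b<length rs. f' 8 = table_start + b * record_len \<and>
        (\<forall>i<length rs. full (snd (rs ! i)) \<longrightarrow> full (snd (rs ! b)) \<and> G (costs (rs ! b)) \<le> G (costs (rs ! i)))))"
      by (rule halts_within_mono[OF best_prog[OF g f ne]]) (use length_le_max_records[OF rs(2)] in auto)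
    fix f' M'
    assume "case (f', M') of (f', M') \<Rightarrow> M' = M \<and> params f' \<and> (\<exists>b<length rs. f' 8 = table_start + b * record_len \<and>
        (\<forall>i<length rs. full (snd (rs ! i)) \<longrightarrow> full (snd (rs ! b)) \<and> G (costs (rs ! b)) \<le> G (costs (rs ! i))))"
    then obtain b where b: "M' = M" "params f'" "b < length rs" "f' 8 = table_start + b * record_len"
      "\<And>i. i < length rs \<Longrightarrow> full (snd (rs ! i)) \<Longrightarrow> full (snd (rs ! b)) \<and> G (costs (rs ! b)) \<le> G (costs (rs ! i))"
      by auto
    have opt: "full (snd (rs ! b)) \<and> G (costs (rs ! b)) \<le> G (costs s)" if s: "valid s" "full (snd s)" for s
    proof -
      from complete[OF s(1)] obtain i where i: "i < length rs" "keys (rs ! i) = keys s" by auto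
      from b(5)[OF i(1)] keys_eq_full[OF i(2)] keys_eq_costs[OF i(2)] s(2) show ?thesis by simp
    qed
    \<comment> \<open>Putting all jobs on machine 1 is valid and complete, which rules out the
      vacuous case.\<close>
    have "full (snd (rs ! b))"
      using opt[of "(1, \<lambda>_. 1)"] machines by (simp add: full_def)
    moreover have "valid (rs ! b)" using rs(2) b(3) by (simp add: table_ok_def)
    moreover have "represents M' (f' 8) (rs ! b)" using b f by (simp add: table_def)
    ultimately show "halts_within (output_prog K) (f', M') (3 * n + 3)
      (\<lambda>s. \<exists>c a. valid (c, a) \<and> full a \<and> result_list s = map a [0..<n] \<and>
      (\<forall>c' a'. valid (c', a') \<longrightarrow> full a' \<longrightarrow> G (costs (c, a)) \<le> G (costs (c', a'))))"
      using opt b(4)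
      by (intro halts_within_mono[OF output_prog[OF b(2)]] exI[of _ "fst (rs ! b)"] exI[of _ "snd (rs ! b)"]) auto
  qed
qed

end

section \<open>Encoded instances and polynomial time\<close>

definition is_poly :: "(nat \<Rightarrow> nat) \<Rightarrow> bool" where
  "is_poly f \<longleftrightarrow> (\<exists>p. \<forall>n. f n = poly p n)"

lemma is_poly_intros:
  "is_poly (\<lambda>_. c)"
  "is_poly (\<lambda>n. n)"
  "is_poly f \<Longrightarrow> is_poly g \<Longrightarrow> is_poly (\<lambda>n. f n + g n)"
  "is_poly f \<Longrightarrow> is_poly g \<Longrightarrow> is_poly (\<lambda>n. f n * g n)"
  "is_poly f \<Longrightarrow> is_poly (\<lambda>n. f n ^ e)"
proof -
  show "is_poly (\<lambda>_. c)" unfolding is_poly_def by (rule exI[of _ "[:c:]"]) simp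
  show "is_poly (\<lambda>n. n)" unfolding is_poly_def by (rule exI[of _ "[:0, 1:]"]) simp
  show "is_poly f \<Longrightarrow> is_poly g \<Longrightarrow> is_poly (\<lambda>n. f n + g n)"
    unfolding is_poly_def by (metis poly_add)
  show "is_poly f \<Longrightarrow> is_poly g \<Longrightarrow> is_poly (\<lambda>n. f n * g n)"
    unfolding is_poly_def by (metis poly_mult)
  show "is_poly f \<Longrightarrow> is_poly (\<lambda>n. f n ^ e)"
    unfolding is_poly_def by (metis poly_power)
qed

text \<open>All coefficients are natural numbers, so no term decreases.\<close>

lemma poly_nat_mono: "x \<le> y \<Longrightarrow> poly p x \<le> poly p y" for p :: "nat poly"
  by (induction p) (auto intro: add_mono mult_mono)

lemma concat_uniform:
  assumes "\<forall>xs\<in>set xss. length xs = n"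
  shows "length (concat xss) = length xss * n"
    and "i < length xss \<Longrightarrow> j < n \<Longrightarrow> concat xss ! (i * n + j) = xss ! i ! j"
proof -
  show "length (concat xss) = length xss * n"
    using assms by (induction xss) auto
  show "i < length xss \<Longrightarrow> j < n \<Longrightarrow> concat xss ! (i * n + j) = xss ! i ! j"
    using assms
  proof (induction xss arbitrary: i)
    case (Cons xs xss)
    then show ?case by (cases i) (auto simp: nth_append add.assoc)
  qed simp
qed

lemma length_le_bit_size: "length xs \<le> bit_size xs"
  unfolding bit_size_def by (induction xs) auto

lemma foldr_max_eq_Max: "xs \<noteq> [] \<Longrightarrow> foldr max xs 0 = Max (set xs)" for xs :: "nat list"
  by (induction xs rule: induct_list012) auto

section \<open>Unit-weight instances in compact form\<close>

definition incidence :: "stc_instance \<Rightarrow> nat \<Rightarrow> nat \<Rightarrow> nat" where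
  "incidence I k j = (if Suc j \<in> scenario I (Suc k) then 1 else 0)"

locale unit_instance =
  fixes I :: stc_instance and K n m :: nat
  assumes valid_I: "valid_instance I" and unit: "unit_weights I"
    and K: "num_scenarios I = K" and n: "num_jobs I = n" and m: "num_machines I = m"
begin

sublocale compact_instance K n m "incidence I"
  by unfold_locales (use valid_I m in \<open>auto simp: valid_instance_def incidence_def\<close>)

lemma encode_instance_nth:
  shows "length (encode_instance I) = table_start" "input_mem (\<lambda>a. if a < length (encode_instance I) then encode_instance I ! a else 0)"
proof -
  define W where "W = concat (map (\<lambda>j. let (a, b) = quotient_of (weight I j) in [nat a, nat b]) [1..<n + 1])"
  define S where "S = map (\<lambda>k. map (\<lambda>j. if j \<in> scenario I k then 1 else 0 :: nat) [1..<n + 1]) [1..<K + 1]"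
  have enc: "encode_instance I = [n, m, K] @ W @ concat S"
    by (simp add: encode_instance_def W_def S_def K n m)
  have W: "length W = n * 2"
    unfolding W_def by (subst concat_uniform(1)[where n = 2]) (auto split: prod.splits)
  have S: "\<forall>xs\<in>set S. length xs = n" "length S = K" by (auto simp: S_def)
  have nth: "concat S ! (k * n + j) = incidence I k j" if "k < K" "j < n" for k j
    using that concat_uniform(2)[OF S(1), of k j] S(2) by (simp add: S_def incidence_def del: upt_Suc)
  show len: "length (encode_instance I) = table_start"
    using concat_uniform(1)[OF S(1)] S(2) W by (simp add: enc table_start_def)
  have "encode_instance I ! (3 + (k + 2) * n + j) = incidence I k j" if "k < K" "j < n" for k j
  proof -
    have *: "3 + (k + 2) * n + j = Suc (Suc (Suc (length W + (k * n + j))))" using W by (simp add: algebra_simps)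
    show ?thesis using nth[OF that] unfolding enc * by (simp add: nth_append)
  qed
  then show "input_mem (\<lambda>a. if a < length (encode_instance I) then encode_instance I ! a else 0)"
    using input_cell_less len by (auto simp: input_mem_def enc)
qed

text \<open>Under unit weights the cost of a machine is the sum of the ranks of its jobs.
  \<open>Suc\<close> translates between numbering from 0 and from 1.\<close>

lemma scenario_cost_eq:
  assumes "k < K"
  shows "scenario_cost I \<phi> (Suc k) = of_nat (cost m (\<lambda>j. \<phi> (Suc j)) k)"
proof -
  have sub: "scenario I (Suc k) \<subseteq> {1..n}"
    using valid_I assms K n by (auto simp: valid_instance_def)
  have "(\<Sum>j\<in>jobs_on I \<phi> i \<inter> scenario I (Suc k).
      weight I j * of_nat (card {j'\<in>jobs_on I \<phi> i \<inter> scenario I (Suc k). j' \<le> j}))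
    = of_nat (tri (load (\<lambda>j. \<phi> (Suc j)) i k))" for i
  proof -
    let ?A = "jobs_on I \<phi> i \<inter> scenario I (Suc k)"
    have fin: "finite ?A" by (simp add: jobs_on_def)
    have "?A = Suc ` {j. j < n \<and> \<phi> (Suc j) = i \<and> incidence I k j \<noteq> 0}"
    proof (intro equalityI subsetI)
      fix j assume "j \<in> ?A"
      then have "j = Suc (j - 1)" "j - 1 \<in> {j. j < n \<and> \<phi> (Suc j) = i \<and> incidence I k j \<noteq> 0}"
        using n by (auto simp: jobs_on_def incidence_def)
      then show "j \<in> Suc ` {j. j < n \<and> \<phi> (Suc j) = i \<and> incidence I k j \<noteq> 0}" by blast
    qed (use n in \<open>auto simp: jobs_on_def incidence_def split: if_splits\<close>)
    then have card: "card ?A = load (\<lambda>j. \<phi> (Suc j)) i k"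
      by (simp add: load_def card_image)
    have "weight I j = 1" if "j \<in> ?A" for j
      using unit that by (simp add: unit_weights_def jobs_on_def)
    then have "(\<Sum>j\<in>?A. weight I j * of_nat (card {j'\<in>?A. j' \<le> j})) = of_nat (\<Sum>j\<in>?A. card {j'\<in>?A. j' \<le> j})"
      by simp
    then show ?thesis unfolding sum_ranks[OF fin] card .
  qed
  then show ?thesis by (simp add: scenario_cost_def cost_def m)
qed

lemma cost_extend:
  assumes "\<And>j. j < n \<Longrightarrow> a j \<le> c" "c \<le> m"
  shows "cost c a k = cost m a k"
  unfolding cost_def
proof (rule sum.mono_neutral_left)
  show "\<forall>i\<in>{1..m} - {1..c}. tri (load a i k) = 0"
  proof
    fix i assume "i \<in> {1..m} - {1..c}"
    then have "{j. j < n \<and> a j = i \<and> incidence I k j \<noteq> 0} = {}" using assms(1) by fastforce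
    then have "load a i k = 0" unfolding load_def by (metis card.empty)
    then show "tri (load a i k) = 0" by simp
  qed
qed (use assms(2) in auto)

text \<open>The search only opens \<open>min m n\<close> machines; this loses nothing, since at most that many
  are nonempty and relabelling machines preserves all costs.\<close>

lemma compress:
  assumes "\<And>j. j < n \<Longrightarrow> a j \<in> {1..m}"
  obtains c a' where "valid (c, a')" "full a'" "\<And>k. cost c a' k = cost m a k"
proof -
  define X where "X = a ` {..<n}"
  have X: "finite X" "X \<subseteq> {1..m}" using assms by (auto simp: X_def)
  then have cX: "card X \<le> n" "card X \<le> m"
    using card_image_le[of "{..<n}" a] card_mono[of "{1..m}" X] by (auto simp: X_def)
  obtain f where f: "bij_betw f X {1..card X}"
    using finite_same_card_bij[OF X(1), of "{1..card X}"] by auto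
  \<comment> \<open>For n = 0 no machine is used, yet a valid state has c \<ge> 1.\<close>
  define c where "c = max 1 (card X)"
  define a' where "a' j = f (a j)" for j
  have a': "a' j \<in> {1..card X}" if "j < n" for j
    using bij_betwE[OF f] that by (auto simp: a'_def X_def)
  have "valid (c, a')"
    using a' cX machines by (auto simp: c_def intro: max.coboundedI2)
  moreover have "full a'" using a' by (force simp: full_def)
  moreover have "cost c a' k = cost m a k" for k
  proof -
    \<comment> \<open>Empty machines contribute \<open>tri 0 = 0\<close>, so both sums shrink to the
      used machines, which \<open>f\<close> matches up.\<close>
    have z: "load b i k = 0" if "i \<notin> b ` {..<n}" for b i
      using that by (auto simp: load_def)
    have img: "a' ` {..<n} = f ` X" by (auto simp: a'_def X_def)
    have fX: "f ` X = {1..card X}" using f by (simp add: bij_betw_def)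
    have "cost c a' k = (\<Sum>i\<in>f ` X. tri (load a' i k))"
      unfolding cost_def by (rule sum.mono_neutral_right) (use z[of _ a'] img fX in \<open>auto simp: c_def\<close>)
    also have "\<dots> = (\<Sum>x\<in>X. tri (load a' (f x) k))"
      by (rule sum.reindex[unfolded o_def]) (use f in \<open>simp add: bij_betw_def\<close>)
    also have "\<dots> = (\<Sum>x\<in>X. tri (load a x k))"
    proof (rule sum.cong)
      fix x assume "x \<in> X"
      then have "a' j = f x \<longleftrightarrow> a j = x" if "j < n" for j
        using f that by (auto simp: a'_def X_def bij_betw_def inj_on_def)
      then have "{j. j < n \<and> a' j = f x \<and> incidence I k j \<noteq> 0} = {j. j < n \<and> a j = x \<and> incidence I k j \<noteq> 0}" by auto
      then show "tri (load a' (f x) k) = tri (load a x k)" by (simp add: load_def)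
    qed simp
    also have "\<dots> = cost m a k"
      unfolding cost_def by (rule sum.mono_neutral_left) (use X z[of _ a] in \<open>auto simp: X_def\<close>)
    finally show ?thesis .
  qed
  ultimately show thesis by (rule that)
qed

text \<open>The assumption on \<open>obj\<close> is the interface for both objectives:
  \<open>obj\<close> is \<open>G\<close> of the scenario costs, taken as natural numbers.\<close>

lemma solver_solves:
  assumes g: "\<And>es s. eval_exp (g es) s = G (map (\<lambda>e. eval_exp e s) es)"
    and obj: "\<And>\<phi> h. (\<And>k. k < K \<Longrightarrow> scenario_cost I \<phi> (Suc k) = of_nat (h k)) \<Longrightarrow>
      obj \<phi> = (of_nat (G (map h [0..<K])) :: rat)"
  shows "halts_within (solver g K) (initial_state (encode_instance I)) total_time
    (\<lambda>s. \<exists>\<phi>. result_list s = encode_assignment I \<phi> \<and> is_arg_min obj (\<lambda>\<psi>. \<psi> \<in> assignments I) \<phi>)"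
  unfolding initial_state_def
proof (rule halts_within_mono[OF solver_correct[where G = G, OF g]])
  fix s
  assume "\<exists>c a. valid (c, a) \<and> full a \<and> result_list s = map a [0..<n] \<and>
      (\<forall>c' a'. valid (c', a') \<longrightarrow> full a' \<longrightarrow> G (costs (c, a)) \<le> G (costs (c', a')))"
  then obtain c a where a: "valid (c, a)" "full a" "result_list s = map a [0..<n]"
    "\<And>c' a'. valid (c', a') \<Longrightarrow> full a' \<Longrightarrow> G (costs (c, a)) \<le> G (costs (c', a'))" by blast
  define \<phi> where "\<phi> = restrict (\<lambda>j. a (j - 1)) {1..n}"
  have obj_eq: "obj \<psi> = of_nat (G (map (cost m (\<lambda>j. \<psi> (Suc j))) [0..<K]))" for \<psi>
    by (rule obj) (rule scenario_cost_eq)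
  have "cost m (\<lambda>j. \<phi> (Suc j)) k = cost c a k" for k
  proof -
    have "load (\<lambda>j. \<phi> (Suc j)) i k = load a i k" for i
      unfolding load_def by (rule arg_cong[of _ _ card]) (auto simp: \<phi>_def)
    then have "cost m (\<lambda>j. \<phi> (Suc j)) k = cost m a k" by (simp add: cost_def)
    with cost_extend[of a c k] a(1) show ?thesis by simp
  qed
  then have "map (cost m (\<lambda>j. \<phi> (Suc j))) [0..<K] = costs (c, a)" by simp
  then have opt: "obj \<phi> = of_nat (G (costs (c, a)))" by (simp only: obj_eq)
  have le: "obj \<phi> \<le> obj \<psi>" if "\<psi> \<in> assignments I" for \<psi>
  proof -
    have "\<psi> (Suc j) \<in> {1..m}" if "j < n" for j
      using \<open>\<psi> \<in> assignments I\<close> that by (auto simp: assignments_def n m Pi_iff PiE_def)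
    \<comment> \<open>A competitor may use machine labels that the search never opens; relabelled,
      it is a state to which the optimality of \<open>a\<close> applies.\<close>
    then obtain c' a' where c': "valid (c', a')" "full a'" "\<And>k. cost c' a' k = cost m (\<lambda>j. \<psi> (Suc j)) k"
      using compress[of "\<lambda>j. \<psi> (Suc j)"] by blast
    have "obj \<psi> = of_nat (G (costs (c', a')))" using ext[of "cost c' a'", OF c'(3)] by (simp add: obj_eq)
    with a(4)[OF c'(1,2)] show ?thesis by (simp only: opt of_nat_le_iff)
  qed
  have "a j \<in> {1..m}" if "j < n" for j
  proof -
    have "a j \<noteq> 0" "a j \<le> c" "c \<le> m" using a(1,2) that by (auto simp: full_def)
    then show ?thesis by simp
  qed
  then have "\<phi> \<in> assignments I"
    by (auto simp: assignments_def n m \<phi>_def)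
  with le have "is_arg_min obj (\<lambda>\<psi>. \<psi> \<in> assignments I) \<phi>"
    by (auto simp: is_arg_min_def not_less)
  moreover have "result_list s = encode_assignment I \<phi>"
    unfolding a(3) encode_assignment_def n by (rule nth_equalityI) (auto simp: \<phi>_def simp del: upt_Suc)
  ultimately show "\<exists>\<phi>. result_list s = encode_assignment I \<phi> \<and> is_arg_min obj (\<lambda>\<psi>. \<psi> \<in> assignments I) \<phi>"
    by blast
qed (use encode_instance_nth in auto)

end

text \<open>The bound depends on K and n only, so a dummy instance with one machine and empty
  scenarios gives access to the definitions. The exponents 3 and \<open>key_len K\<close> do not
  involve n.\<close>

lemma is_poly_total_time: "is_poly (compact_instance.total_time K)"
proof -
  interpret compact_instance K n 1 "\<lambda>_ _. 0" for n by unfold_locales auto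
  show ?thesis
    unfolding total_time_def max_records_def expand_time_def body_time_def record_len_def
    by (intro is_poly_intros)
qed

lemma poly_time_solvable_unit_weights:
  assumes g: "\<And>es s. eval_exp (g es) s = G (map (\<lambda>e. eval_exp e s) es)"
    and obj: "\<And>I \<phi> h. valid_instance I \<Longrightarrow> num_scenarios I = K \<Longrightarrow>
      (\<And>k. k < K \<Longrightarrow> scenario_cost I \<phi> (Suc k) = of_nat (h k)) \<Longrightarrow>
      obj I \<phi> = (of_nat (G (map h [0..<K])) :: rat)"
  shows "poly_time_solvable encode_instance encode_assignment
    {I. valid_instance I \<and> num_scenarios I = K \<and> unit_weights I}
    (\<lambda>I. is_arg_min (obj I) (\<lambda>\<psi>. \<psi> \<in> assignments I))"
proof -
  obtain p where p: "\<And>n. compact_instance.total_time K n = poly p n"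
    using is_poly_total_time[of K] by (auto simp: is_poly_def)
  show ?thesis
    unfolding poly_time_solvable_def
  proof (rule exI[of _ "solver g K"], rule exI[of _ p], rule ballI)
    fix I assume "I \<in> {I. valid_instance I \<and> num_scenarios I = K \<and> unit_weights I}"
    then interpret unit_instance I K "num_jobs I" "num_machines I"
      by unfold_locales auto
    \<comment> \<open>The time bound is in n alone; n is at most the number of input entries, each
      of which adds at least its delimiter to the bit size.\<close>
    have "num_jobs I \<le> length (encode_instance I)"
      by (simp add: encode_instance_nth(1) table_start_def)
    also have "\<dots> \<le> bit_size (encode_instance I)" by (rule length_le_bit_size)
    finally have "total_time \<le> poly p (bit_size (encode_instance I))"
      unfolding p by (rule poly_nat_mono)
    with solver_solves[where obj = "obj I", OF g obj[OF valid_I K]]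
    show "\<exists>t s x. exec (solver g K) (initial_state (encode_instance I)) t s \<and>
        t \<le> poly p (bit_size (encode_instance I)) \<and> result_list s = encode_assignment I x \<and>
        is_arg_min (obj I) (\<lambda>\<psi>. \<psi> \<in> assignments I) x"
      unfolding halts_within_def by (meson order_trans)
  qed
qed

theorem theorem4:
  fixes K :: nat
  shows
    "poly_time_solvable encode_instance encode_assignment
       {I. valid_instance I \<and> num_scenarios I = K \<and> unit_weights I} MinMaxSTC \<and>
     poly_time_solvable encode_instance encode_assignment
       {I. valid_instance I \<and> num_scenarios I = K \<and> unit_weights I} MinAvgSTC"
proof
  have image: "{1..K} = Suc ` {0..<K}" by (simp add: image_Suc_atLeastLessThan atLeastLessThanSuc_atLeastAtMost)
  have "MinMaxSTC = (\<lambda>I. is_arg_min (max_cost I) (\<lambda>\<psi>. \<psi> \<in> assignments I))"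
    by (simp add: fun_eq_iff MinMaxSTC_def)
  moreover have "max_cost I \<phi> = of_nat (foldr max (map h [0..<K]) 0)"
    if "valid_instance I" "num_scenarios I = K" "\<And>k. k < K \<Longrightarrow> scenario_cost I \<phi> (Suc k) = of_nat (h k)"
    for I \<phi> and h :: "nat \<Rightarrow> nat"
  proof -
    \<comment> \<open>Validity demands a scenario, so the maximum ranges over a nonempty set; the
      start value 0 of the fold is harmless for natural numbers.\<close>
    have "K \<noteq> 0" using that by (auto simp: valid_instance_def)
    then have "foldr max (map h [0..<K]) 0 = Max (h ` {0..<K})"
      by (subst foldr_max_eq_Max) auto
    moreover have "scenario_cost I \<phi> ` {1..K} = of_nat ` h ` {0..<K}"
      unfolding image image_image by (rule image_cong) (use that(3) in auto)
    moreover have "(of_nat (Max (h ` {0..<K})) :: rat) = Max (of_nat ` h ` {0..<K})"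
      using \<open>K \<noteq> 0\<close> by (intro mono_Max_commute) (auto simp: mono_def)
    ultimately show ?thesis by (simp add: max_cost_def that(2))
  qed
  ultimately show "poly_time_solvable encode_instance encode_assignment
       {I. valid_instance I \<and> num_scenarios I = K \<and> unit_weights I} MinMaxSTC"
    using poly_time_solvable_unit_weights[of max_exp "\<lambda>xs. foldr max xs 0" K max_cost]
    by (simp add: eval_max_exp)
  have "MinAvgSTC = (\<lambda>I. is_arg_min (total_cost I) (\<lambda>\<psi>. \<psi> \<in> assignments I))"
    by (simp add: fun_eq_iff MinAvgSTC_def)
  moreover have "total_cost I \<phi> = of_nat (sum_list (map h [0..<K]))"
    if "valid_instance I" "num_scenarios I = K" "\<And>k. k < K \<Longrightarrow> scenario_cost I \<phi> (Suc k) = of_nat (h k)"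
    for I \<phi> and h :: "nat \<Rightarrow> nat"
  proof -
    have "total_cost I \<phi> = (\<Sum>k\<in>{0..<K}. scenario_cost I \<phi> (Suc k))"
      unfolding total_cost_def that(2) image by (subst sum.reindex) auto
    also have "\<dots> = of_nat (sum_list (map h [0..<K]))"
      using that(3) by (simp add: interv_sum_list_conv_sum_set_nat)
    finally show ?thesis .
  qed
  ultimately show "poly_time_solvable encode_instance encode_assignment
       {I. valid_instance I \<and> num_scenarios I = K \<and> unit_weights I} MinAvgSTC"
    using poly_time_solvable_unit_weights[of sum_exp sum_list K total_cost]
    by (simp add: eval_sum_exp)
qed

end
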